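(* Let $r>0$, $\alpha>1$, let $\pmb\theta\in\mathbb{R}^n$ be fixed, and let $g_{\pmb\theta}:\mathbb{N}\times\mathbb{R}^+\to\mathbb{R}^+$. Consider the BNB autoregressive process given by $$y_t\mid\mathcal{F}_{t-1}\sim\mathcal{BNB}(\lambda_t,r,\alpha),\qquad \lambda_{t+1}=g_{\pmb\theta}(y_t,\lambda_t),\qquad t\in\mathbb{Z}.$$ Assume that there are positive constants $c_1,c_2$ with $c_1+c_2<1$ such that $$|g_{\pmb\theta}(y,\lambda)-g_{\pmb\theta}(y^*,\lambda^* )|\le c_1|y-y^*|+c_2|\lambda-\lambda^*|$$ for all $y,y^*\in\mathbb{N}$ and $\lambda,\lambda^*\in\mathbb{R}^+$. Then: (i) There exists a unique strictly stationary and ergodic causal solution $\{(y_t,\lambda_t)\}_{t\in\mathbb{Z}}$ with finite first moment $\mathbb{E}(y_t)<\infty$. (ii) There exists a measurable function $g^\infty_{\pmb\theta}$ such that $\lambda_t=g^\infty_{\pmb\theta}(y_{t-1},y_{t-2},\dots)$, i.e. $\lambda_t$ is $\mathcal{F}_{t-1}$-measurable.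
   Context: $\mathbb{N}=\{0,1,2,\dots\}$, $\mathbb{R}^+=(0,\infty)$. For $\lambda>0$, $r>0$, $\alpha>1$, the beta negative binomial distribution $\mathcal{BNB}(\lambda,r,\alpha)$ is the distribution on $\mathbb{N}$ with probability mass function $$p(y|\lambda,r,\alpha)=\frac{\Gamma(y+r)}{\Gamma(y+1)\Gamma(r)}\,\frac{B(\alpha+r,(\alpha-1)\lambda/r+y)}{B(\alpha,(\alpha-1)\lambda/r)},$$ where $\Gamma$ is the gamma function and $B$ the beta function; its mean is $\lambda$. $\mathcal{F}_t$ is the $\sigma$-field generated by $\{y_t,y_{t-1},\dots\}$. The process equations are realized as $y_t=F^{-1}_{\lambda_t}(u_t)$, $\lambda_{t+1}=g_{\pmb\theta}(F^{-1}_{\lambda_t}(u_t),\lambda_t)$, where $\{u_t\}_{t\in\mathbb{Z}}$ is an i.i.d. sequence of uniform $\mathcal{U}(0,1)$ random variables, $F_\lambda$ is the cumulative distribution function of $\mathcal{BNB}(\lambda,r,\alpha)$ and $F_\lambda^{-1}(u)=\inf\{z\in\mathbb{R}:u\le F_\lambda(z)\}$. A solution is causal if $\lambda_t$ is a measurable function of $(u_{t-1},u_{t-2},\dots)$ for each $t$ (and hence $y_t$ of $(u_t,u_{t-1},\dots)$).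
   Formalization: It is additionally assumed that g_θ(0,λ) does not tend to 0 as λ→0+; otherwise (e.g. g = y/4 + λ/4) the Lipschitz bound forces E(λ_t) ≤ (c_1+c_2)E(λ_t), hence E(λ_t)=0, so no positive solution as in (i) exists. *)

theory Defs
  imports "HOL-Probability.Probability"
begin

definition bnb_mass :: "real \<Rightarrow> real \<Rightarrow> real \<Rightarrow> nat \<Rightarrow> real" where
  "bnb_mass l r \<alpha> y =
     Gamma (real y + r) / (Gamma (real y + 1) * Gamma r) *
     (Beta (\<alpha> + r) ((\<alpha> - 1) * l / r + real y) / Beta \<alpha> ((\<alpha> - 1) * l / r))"

definition bnb :: "real \<Rightarrow> real \<Rightarrow> real \<Rightarrow> nat measure" where
  "bnb l r \<alpha> = density (count_space UNIV) (\<lambda>y. ennreal (bnb_mass l r \<alpha> y))"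

definition bnb_cdf :: "real \<Rightarrow> real \<Rightarrow> real \<Rightarrow> real \<Rightarrow> real" where
  "bnb_cdf l r \<alpha> = cdf (distr (bnb l r \<alpha>) borel real)"

text \<open>Only meaningful for \<open>0 < u < 1\<close>; outside that interval the set below may be empty or
  unbounded below.\<close>

definition bnb_quantile :: "real \<Rightarrow> real \<Rightarrow> real \<Rightarrow> real \<Rightarrow> real" where
  "bnb_quantile l r \<alpha> u = Inf {z. u \<le> bnb_cdf l r \<alpha> z}"

text \<open>Stationarity and ergodicity are properties of the law of the whole two-sided path on the
  product space \<open>N\<close> to the power \<open>\<int>\<close>. Both presuppose that every \<open>X t\<close> is measurable
  from \<open>M\<close> to \<open>N\<close>.\<close>

definition strictly_stationary ::
    "'a measure \<Rightarrow> 'b measure \<Rightarrow> (int \<Rightarrow> 'a \<Rightarrow> 'b) \<Rightarrow> bool" where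
  "strictly_stationary M N X \<longleftrightarrow>
     (\<forall>k. distr M (Pi\<^sub>M UNIV (\<lambda>_::int. N)) (\<lambda>\<omega> t. X (t + k) \<omega>) =
          distr M (Pi\<^sub>M UNIV (\<lambda>_::int. N)) (\<lambda>\<omega> t. X t \<omega>))"

definition ergodic_process ::
    "'a measure \<Rightarrow> 'b measure \<Rightarrow> (int \<Rightarrow> 'a \<Rightarrow> 'b) \<Rightarrow> bool" where
  "ergodic_process M N X \<longleftrightarrow>
     (\<forall>A \<in> sets (Pi\<^sub>M UNIV (\<lambda>_::int. N)).
        (\<lambda>x t. x (t + 1)) -` A \<inter> space (Pi\<^sub>M UNIV (\<lambda>_::int. N)) = A \<longrightarrow>
        measure M {\<omega> \<in> space M. (\<lambda>t. X t \<omega>) \<in> A} \<in> {0, 1})"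

definition iid_uniform :: "'a measure \<Rightarrow> (int \<Rightarrow> 'a \<Rightarrow> real) \<Rightarrow> bool" where
  "iid_uniform M u \<longleftrightarrow>
     prob_space.indep_vars M (\<lambda>_. borel) u UNIV \<and>
     (\<forall>t. distr M borel (u t) = uniform_measure lborel {0<..<1})"

text \<open>The equations are required almost surely, simultaneously for all times. The intensity
  has to be strictly positive, as the distribution and \<open>G\<close> are only given there. If
  \<open>G 0 l\<close> tends to \<open>0\<close> as \<open>l\<close> decreases to \<open>0\<close>, such as for
  \<open>G y l = y / 4 + l / 4\<close>, the contraction drives every solution to the degenerate state
  \<open>(0, 0)\<close>, and no strictly positive stationary causal solution with finite mean exists.
  Existence theorems therefore have to exclude that case.\<close>

definition bnb_ar_solution ::
    "'a measure \<Rightarrow> real \<Rightarrow> real \<Rightarrow> (nat \<Rightarrow> real \<Rightarrow> real) \<Rightarrow> (int \<Rightarrow> 'a \<Rightarrow> real) \<Rightarrow>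
     (int \<Rightarrow> 'a \<Rightarrow> nat) \<Rightarrow> (int \<Rightarrow> 'a \<Rightarrow> real) \<Rightarrow> bool" where
  "bnb_ar_solution M r \<alpha> G u y l \<longleftrightarrow>
     (\<forall>t. y t \<in> measurable M (count_space UNIV) \<and> l t \<in> borel_measurable M) \<and>
     (AE \<omega> in M. \<forall>t. 0 < l t \<omega> \<and>
        real (y t \<omega>) = bnb_quantile (l t \<omega>) r \<alpha> (u t \<omega>) \<and>
        l (t + 1) \<omega> = G (y t \<omega>) (l t \<omega>))"

definition causal ::
    "'a measure \<Rightarrow> (int \<Rightarrow> 'a \<Rightarrow> real) \<Rightarrow> (int \<Rightarrow> 'a \<Rightarrow> real) \<Rightarrow> bool" where
  "causal M u l \<longleftrightarrow>
     (\<forall>t. \<exists>h \<in> borel_measurable (Pi\<^sub>M UNIV (\<lambda>_::nat. borel)).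
        AE \<omega> in M. l t \<omega> = h (\<lambda>i. u (t - 1 - int i) \<omega>))"

definition stationary_ergodic_causal_solution ::
    "'a measure \<Rightarrow> real \<Rightarrow> real \<Rightarrow> (nat \<Rightarrow> real \<Rightarrow> real) \<Rightarrow> (int \<Rightarrow> 'a \<Rightarrow> real) \<Rightarrow>
     (int \<Rightarrow> 'a \<Rightarrow> nat) \<Rightarrow> (int \<Rightarrow> 'a \<Rightarrow> real) \<Rightarrow> bool" where
  "stationary_ergodic_causal_solution M r \<alpha> G u y l \<longleftrightarrow>
     bnb_ar_solution M r \<alpha> G u y l \<and>
     strictly_stationary M (count_space UNIV \<Otimes>\<^sub>M borel) (\<lambda>t \<omega>. (y t \<omega>, l t \<omega>)) \<and>
     ergodic_process M (count_space UNIV \<Otimes>\<^sub>M borel) (\<lambda>t \<omega>. (y t \<omega>, l t \<omega>)) \<and>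
     causal M u l \<and>
     (\<forall>t. integrable M (\<lambda>\<omega>. real (y t \<omega>)))"

definition past_sigma :: "'a measure \<Rightarrow> (int \<Rightarrow> 'a \<Rightarrow> nat) \<Rightarrow> int \<Rightarrow> 'a measure" where
  "past_sigma M y t = sigma (space M) {y s -` A \<inter> space M | s A. s \<le> t}"

text \<open>The model relation \<open>y\<^sub>t | F\<^sub>t\<^sub>-\<^sub>1 \<sim> BNB(l\<^sub>t, r, \<alpha>)\<close>. It is not part of
  \<open>bnb_ar_solution\<close>: assuming it there would presuppose that \<open>l\<^sub>t\<close> is
  measurable with respect to the past of \<open>y\<close>.\<close>

definition conditionally_bnb ::
    "'a measure \<Rightarrow> real \<Rightarrow> real \<Rightarrow> (int \<Rightarrow> 'a \<Rightarrow> nat) \<Rightarrow> (int \<Rightarrow> 'a \<Rightarrow> real) \<Rightarrow> bool" where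
  "conditionally_bnb M r \<alpha> y l \<longleftrightarrow>
     (\<forall>t k. AE \<omega> in M.
        real_cond_exp M (past_sigma M y (t - 1)) (indicator {\<omega>. y t \<omega> = k}) \<omega> =
          bnb_mass (l t \<omega>) r \<alpha> k)"

end

theory Submission
  imports Defs
begin

text \<open>
  The recursion is read as a random map on intensities. A uniform variable \<open>v\<close> sends the
  intensity \<open>l\<close> to \<open>step v l\<close>, which applies \<open>G\<close> to \<open>l\<close> and to the quantile of
  level \<open>v\<close> of the count distribution with mean \<open>l\<close>.

  This map contracts in mean. The beta negative binomial masses have monotone likelihood ratios in
  the intensity, hence their quantiles increase with it, and two counts driven by the same uniform
  variable have a mean distance equal to the distance of the intensities
  (\<open>nn_integral_bnb_count_diff\<close>). Together with the Lipschitz bound on \<open>G\<close> this gives the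
  factor \<open>\<kappa> = c1 + c2 < 1\<close> (\<open>nn_integral_step_diff\<close>).

  Iterating backwards in time along a sequence of independent uniform innovations therefore
  converges almost surely and in mean, to a function \<open>limit\<close> of the past innovations that
  satisfies the recursion (\<open>AE_limit_step\<close>). The limit is a priori only nonnegative, so the
  map is extended to the state \<open>0\<close>, where the count is \<open>0\<close>; the value there is the limit
  \<open>a\<close> of \<open>G 0\<close> at \<open>0\<close>. As \<open>a > 0\<close>, the extended map takes positive values only, and
  the limit is positive after all.

  Stationarity holds because the solution is a function of the innovations that commutes with time
  shifts, and ergodicity because the shift on an independent sequence is mixing
  (\<open>shift_ergodic\<close>). Any other causal stationary solution with finite mean has mean distance
  zero from this one by the same contraction (\<open>solution_unique\<close>). Finally, for given counts the
  recursion of the intensity is a contraction with factor \<open>c2\<close>, so the intensity can be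
  reconstructed from the past counts alone (\<open>AE_intensity_eq_unrolled\<close>). This
  makes it measurable with respect to the past of the counts, as the conditional distribution
  requires (\<open>conditionally_bnb_obs\<close>).
\<close>

section \<open>The beta negative binomial distribution\<close>

definition nb_coeff :: "real \<Rightarrow> nat \<Rightarrow> real" where
  "nb_coeff r y = Gamma (real y + r) / (Gamma (real y + 1) * Gamma r)"

lemma pos_notin_nonpos_Ints: "x > (0::real) \<Longrightarrow> x \<notin> \<int>\<^sub>\<le>\<^sub>0"
  by (metis nonpos_Ints_cases not_less of_int_le_0_iff)

lemma nb_coeff_pochhammer:
  assumes "r > 0"
  shows "nb_coeff r y = pochhammer r y / fact y"
proof -
  have "pochhammer r y = Gamma (r + real y) / Gamma r"
    by (rule pochhammer_Gamma[OF pos_notin_nonpos_Ints[OF assms]])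
  moreover have "Gamma (real y + 1) = fact y"
    using Gamma_fact[of y, where 'a = real] by (metis add.commute)
  ultimately show ?thesis unfolding nb_coeff_def by (metis add.commute divide_divide_eq_left mult.commute)
qed

lemma nb_coeff_pos: "r > 0 \<Longrightarrow> nb_coeff r y > 0"
  by (simp add: nb_coeff_def)

lemma nb_coeff_sums:
  assumes "r > 0" "0 \<le> x" "x < 1"
  shows "(\<lambda>y. nb_coeff r y * x ^ y) sums ((1 - x) powr (- r))"
proof -
  have "(\<lambda>n. (- r gchoose n) * (- x) ^ n) sums (1 + (- x)) powr (- r)"
    using assms by (intro gen_binomial_real) auto
  moreover have "(- r gchoose n) * (- x) ^ n = nb_coeff r n * x ^ n" for n
  proof -
    have "(- 1) ^ n * (- x) ^ n = x ^ n"
      by (simp only: power_mult_distrib[symmetric]) simp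
    moreover have "(- r gchoose n) * (- x) ^ n = pochhammer r n / fact n * ((- 1) ^ n * (- x) ^ n)"
      unfolding gbinomial_pochhammer by (simp only: minus_minus mult_ac times_divide_eq_left times_divide_eq_right)
    ultimately show ?thesis by (simp add: nb_coeff_pochhammer[OF assms(1)])
  qed
  ultimately show ?thesis by simp
qed

lemma nn_integral_Beta:
  assumes "a > 0" "b > (0::real)"
  shows "(\<integral>\<^sup>+ x. ennreal (indicator {0<..<1} x * (x powr (a - 1) * (1 - x) powr (b - 1))) \<partial>lborel)
    = ennreal (Beta a b)"
proof -
  have "((\<lambda>x. x powr (a - 1) * (1 - x) powr (b - 1)) has_integral Beta a b) {0<..<1}"
    using has_integral_Beta_real[OF assms] by (simp add: has_integral_Icc_iff_Ioo)
  from nn_integral_has_integral_lebesgue[OF _ this] show ?thesis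
    by simp
qed

text \<open>This is Gauss' summation formula for the hypergeometric series at \<open>1\<close>. It says that
  a negative binomial weight mixed over a beta distributed success probability has total mass
  one.\<close>

lemma suminf_nb_coeff_Beta:
  assumes "r > 0" "a > 0" "b > 0"
  shows "(\<Sum>y. ennreal (nb_coeff r y * Beta (a + r) (b + real y))) = ennreal (Beta a b)"
proof -
  \<comment> \<open>The variable \<open>x\<close> is the probability of failure.\<close>
  let ?w = "\<lambda>y x. indicator {0<..<1} x * (x powr (b + real y - 1) * (1 - x) powr (a + r - 1))"
  have "ennreal (nb_coeff r y * Beta (a + r) (b + real y))
      = (\<integral>\<^sup>+ x. ennreal (nb_coeff r y * ?w y x) \<partial>lborel)" for y
    using nn_integral_Beta[of "b + real y" "a + r"] assms nb_coeff_pos[of r y]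
    by (simp add: ennreal_mult' nn_integral_cmult Beta_commute[of "a + r"])
  hence "(\<Sum>y. ennreal (nb_coeff r y * Beta (a + r) (b + real y)))
      = (\<integral>\<^sup>+ x. (\<Sum>y. ennreal (nb_coeff r y * ?w y x)) \<partial>lborel)"
    by (simp add: nn_integral_suminf)
  also have "\<dots> = (\<integral>\<^sup>+ x. ennreal (indicator {0<..<1} x * (x powr (b - 1) * (1 - x) powr (a - 1))) \<partial>lborel)"
  proof (intro nn_integral_cong)
    fix x :: real
    show "(\<Sum>y. ennreal (nb_coeff r y * ?w y x))
        = ennreal (indicator {0<..<1} x * (x powr (b - 1) * (1 - x) powr (a - 1)))"
    proof (cases "x \<in> {0<..<1}")
      case True
      have "(\<lambda>y. (nb_coeff r y * x ^ y) * (x powr (b - 1) * (1 - x) powr (a + r - 1))) sums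
          ((1 - x) powr (- r) * (x powr (b - 1) * (1 - x) powr (a + r - 1)))"
        using True assms by (intro sums_mult2 nb_coeff_sums) auto
      also have "(1 - x) powr (- r) * (x powr (b - 1) * (1 - x) powr (a + r - 1))
          = x powr (b - 1) * ((1 - x) powr (- r) * (1 - x) powr (a + r - 1))"
        by (simp only: mult_ac)
      also have "\<dots> = x powr (b - 1) * (1 - x) powr (a - 1)"
        using True by (subst powr_add[symmetric]) simp
      also have "(\<lambda>y. (nb_coeff r y * x ^ y) * (x powr (b - 1) * (1 - x) powr (a + r - 1)))
          = (\<lambda>y. nb_coeff r y * ?w y x)"
      proof
        fix y
        have "x powr (b + real y - 1) = x powr (b - 1) * x powr real y"
          by (simp flip: powr_add add: algebra_simps)
        also have "x powr real y = x ^ y" using True by (simp add: powr_realpow)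
        finally show "(nb_coeff r y * x ^ y) * (x powr (b - 1) * (1 - x) powr (a + r - 1))
          = nb_coeff r y * ?w y x" using True by simp
      qed
      finally show ?thesis
        using True assms nb_coeff_pos[of r]
        by (subst suminf_ennreal_eq) (auto intro!: mult_nonneg_nonneg less_imp_le)
    qed simp
  qed
  also have "\<dots> = ennreal (Beta a b)"
    unfolding nn_integral_Beta[OF assms(3,2)] Beta_commute[of b a] ..
  finally show ?thesis .
qed

lemma Beta_pos: "a > 0 \<Longrightarrow> b > 0 \<Longrightarrow> Beta a b > (0::real)"
  unfolding Beta_def by (intro divide_pos_pos mult_pos_pos Gamma_real_pos add_pos_pos)

context
  fixes r \<alpha> :: real
  assumes r: "r > 0" and \<alpha>: "\<alpha> > 1"
begin

abbreviation shape :: "real \<Rightarrow> real" where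
  "shape l \<equiv> (\<alpha> - 1) * l / r"

lemma bnb_mass_pos: "l > 0 \<Longrightarrow> bnb_mass l r \<alpha> y > 0"
  unfolding bnb_mass_def nb_coeff_def[symmetric] using r \<alpha>
  by (intro mult_pos_pos divide_pos_pos nb_coeff_pos Beta_pos add_pos_nonneg) auto

lemma suminf_bnb_mass:
  assumes "l > 0"
  shows "(\<Sum>y. ennreal (bnb_mass l r \<alpha> y)) = 1"
proof -
  have sh: "shape l > 0" using assms r \<alpha> by simp
  have B: "Beta \<alpha> (shape l) > 0" using sh \<alpha> by (intro Beta_pos) auto
  have "ennreal (bnb_mass l r \<alpha> y) = ennreal (nb_coeff r y * Beta (\<alpha> + r) (shape l + real y))
      * ennreal (1 / Beta \<alpha> (shape l))" for y
    using B r \<alpha> sh Beta_pos[of "\<alpha> + r" "shape l + real y"] nb_coeff_pos[of r y]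
    by (subst ennreal_mult'[symmetric])
      (auto simp: bnb_mass_def nb_coeff_def intro!: divide_nonneg_nonneg mult_nonneg_nonneg less_imp_le)
  hence "(\<Sum>y. ennreal (bnb_mass l r \<alpha> y)) = ennreal (Beta \<alpha> (shape l)) * ennreal (1 / Beta \<alpha> (shape l))"
    using suminf_nb_coeff_Beta[of r \<alpha> "shape l"] r \<alpha> sh by simp
  also have "\<dots> = 1" using B by (subst ennreal_mult[symmetric]) auto
  finally show ?thesis .
qed

text \<open>The factor \<open>y\<close> cancels against the factorial, which leaves the masses with \<open>r\<close>,
  \<open>\<alpha>\<close> and the shape moved to \<open>r + 1\<close>, \<open>\<alpha> - 1\<close> and \<open>shape l + 1\<close>. Their
  sum is known, and the quotient of beta functions that remains is \<open>l\<close>. The condition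
  \<open>\<alpha> > 1\<close> is what makes the moved parameter positive.\<close>

lemma suminf_bnb_mass_mean:
  assumes "l > 0"
  shows "(\<Sum>y. ennreal (real y) * ennreal (bnb_mass l r \<alpha> y)) = ennreal l"
proof -
  have sh: "shape l > 0" using assms r \<alpha> by simp
  have B: "Beta \<alpha> (shape l) > 0" using sh \<alpha> by (intro Beta_pos) auto
  have step: "ennreal (real (Suc y)) * ennreal (bnb_mass l r \<alpha> (Suc y))
      = ennreal (nb_coeff (r + 1) y * Beta ((\<alpha> - 1) + (r + 1)) ((shape l + 1) + real y))
        * ennreal (r / Beta \<alpha> (shape l))" for y
  proof -
    have "real (Suc y) * nb_coeff r (Suc y) = r * nb_coeff (r + 1) y"
      using r by (simp add: nb_coeff_pochhammer pochhammer_rec field_simps del: of_nat_Suc)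
    hence "real (Suc y) * bnb_mass l r \<alpha> (Suc y)
       = (r * nb_coeff (r + 1) y) * (Beta (\<alpha> + r) (shape l + real (Suc y)) / Beta \<alpha> (shape l))"
      unfolding bnb_mass_def nb_coeff_def[symmetric] by (simp only: mult.assoc[symmetric])
    also have "shape l + real (Suc y) = shape l + 1 + real y" by simp
    finally have "real (Suc y) * bnb_mass l r \<alpha> (Suc y)
       = (nb_coeff (r + 1) y * Beta ((\<alpha> - 1) + (r + 1)) ((shape l + 1) + real y)) * (r / Beta \<alpha> (shape l))"
      by simp
    moreover have "Beta ((\<alpha> - 1) + (r + 1)) ((shape l + 1) + real y) > 0"
      using sh r \<alpha> by (intro Beta_pos) auto
    ultimately show ?thesis
      using r B nb_coeff_pos[of "r + 1" y]
      by (subst (1 2) ennreal_mult'[symmetric]) (simp_all add: less_imp_le)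
  qed
  have "(\<Sum>y. ennreal (real y) * ennreal (bnb_mass l r \<alpha> y))
      = (\<Sum>y. ennreal (real (Suc y)) * ennreal (bnb_mass l r \<alpha> (Suc y)))"
    by (subst suminf_offset[of _ 1]) auto
  also have "\<dots> = ennreal (Beta (\<alpha> - 1) (shape l + 1)) * ennreal (r / Beta \<alpha> (shape l))"
    unfolding step using suminf_nb_coeff_Beta[of "r + 1" "\<alpha> - 1" "shape l + 1"] r \<alpha> sh by simp
  also have "\<dots> = ennreal (Beta (\<alpha> - 1) (shape l + 1) * (r / Beta \<alpha> (shape l)))"
    using B r \<alpha> sh by (subst ennreal_mult) (auto intro!: less_imp_le Beta_pos)
  also have "Beta (\<alpha> - 1) (shape l + 1) * (r / Beta \<alpha> (shape l)) = l"
  proof -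
    have 1: "Gamma (shape l + 1) = shape l * Gamma (shape l)"
      by (rule Gamma_plus1[OF pos_notin_nonpos_Ints[OF sh]])
    have 2: "Gamma (\<alpha> - 1 + 1) = (\<alpha> - 1) * Gamma (\<alpha> - 1)"
      using \<alpha> by (intro Gamma_plus1 pos_notin_nonpos_Ints) auto
    have "\<alpha> - 1 + (shape l + 1) = \<alpha> + shape l" by simp
    moreover have "Gamma (\<alpha> - 1) \<noteq> 0" "Gamma (shape l) \<noteq> 0" "Gamma (\<alpha> + shape l) \<noteq> 0"
      using Gamma_real_pos[of "\<alpha> - 1"] Gamma_real_pos[OF sh] Gamma_real_pos[of "\<alpha> + shape l"] sh \<alpha>
      by linarith+
    ultimately show ?thesis using 1 2 r \<alpha> by (simp add: Beta_def)
  qed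
  finally show ?thesis .
qed

lemma bnb_mass_Suc:
  assumes "l > 0"
  shows "bnb_mass l r \<alpha> (Suc y) = bnb_mass l r \<alpha> y *
    ((real y + r) / (real y + 1) * ((shape l + real y) / (\<alpha> + r + shape l + real y)))"
proof -
  have sh: "shape l > 0" using assms r \<alpha> by simp
  have rec: "Gamma (x + 1) = x * Gamma x" if "x > 0" for x :: real
    by (rule Gamma_plus1[OF pos_notin_nonpos_Ints[OF that]])
  have e: "real (Suc y) + r = (real y + r) + 1" "real (Suc y) + 1 = (real y + 1) + 1"
    "shape l + real (Suc y) = (shape l + real y) + 1"
    "\<alpha> + r + ((shape l + real y) + 1) = (\<alpha> + r + shape l + real y) + 1"
    by simp_all
  have [simp]: "\<alpha> + r + (shape l + real y) = \<alpha> + r + shape l + real y" by simp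
  have p: "real y + r > 0" "real y + 1 > 0" "shape l + real y > 0"
    "\<alpha> + r + shape l + real y > 0"
    using r sh \<alpha> by (auto intro: add_nonneg_pos add_pos_nonneg add_pos_pos)
  have "nb_coeff r (Suc y) = nb_coeff r y * ((real y + r) / (real y + 1))"
    unfolding nb_coeff_def e rec[OF p(1)] rec[OF p(2)] by (simp add: mult_ac)
  moreover have "Beta (\<alpha> + r) (shape l + real (Suc y)) = Beta (\<alpha> + r) (shape l + real y) *
      ((shape l + real y) / (\<alpha> + r + shape l + real y))"
    unfolding Beta_def e rec[OF p(3)] rec[OF p(4)] by (simp only: times_divide_times_eq ac_simps)
  ultimately show ?thesis
    unfolding bnb_mass_def nb_coeff_def[symmetric]
    by (simp only: times_divide_times_eq times_divide_eq_left times_divide_eq_right divide_divide_eq_left mult_ac)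
qed

text \<open>The likelihood ratio of two intensities is monotone in the count. Increasing the count by
  one multiplies the mass by a common factor times \<open>b / (\<alpha> + r + b)\<close> with \<open>b\<close> the
  shape plus the count, and this quotient increases with \<open>b\<close>, hence with the intensity.\<close>

lemma bnb_mass_ratio_mono:
  assumes l: "0 < l" "l \<le> l'" and "i \<le> j"
  shows "bnb_mass l' r \<alpha> i * bnb_mass l r \<alpha> j \<le> bnb_mass l r \<alpha> i * bnb_mass l' r \<alpha> j"
  using \<open>i \<le> j\<close>
proof (induction j rule: dec_induct)
  case (step j)
  let ?q = "\<lambda>l. (shape l + real j) / (\<alpha> + r + shape l + real j)"
  let ?c = "(real j + r) / (real j + 1)"
  have sh: "shape l > 0" "shape l \<le> shape l'"
    using l r \<alpha> by (auto intro!: divide_right_mono mult_left_mono)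
  have q0: "?q l \<ge> 0" using sh r \<alpha> by (intro divide_nonneg_nonneg) auto
  have q: "?q l \<le> ?q l'"
  proof -
    have frac: "x / (s + x) \<le> x' / (s + x')" if "0 \<le> x" "x \<le> x'" "0 < s" for x x' s :: real
      using that by (simp add: divide_simps) (simp add: algebra_simps mult_left_mono)
    show ?thesis
      using frac[of "shape l + real j" "shape l' + real j" "\<alpha> + r"] sh r \<alpha> by (simp add: add.assoc)
  qed
  have c: "?c \<ge> 0" using r by simp
  have l': "l' > 0" using l by simp
  have pos: "bnb_mass l r \<alpha> i * bnb_mass l' r \<alpha> j \<ge> 0"
    using bnb_mass_pos[OF l(1), of i] bnb_mass_pos[OF l', of j] by simp
  have "bnb_mass l' r \<alpha> i * bnb_mass l r \<alpha> (Suc j)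
      = (bnb_mass l' r \<alpha> i * bnb_mass l r \<alpha> j) * (?c * ?q l)"
    by (simp only: bnb_mass_Suc[OF l(1)] mult_ac)
  also have "\<dots> \<le> (bnb_mass l r \<alpha> i * bnb_mass l' r \<alpha> j) * (?c * ?q l')"
    by (intro mult_mono step.IH mult_left_mono q c pos mult_nonneg_nonneg q0)
  also have "\<dots> = bnb_mass l r \<alpha> i * bnb_mass l' r \<alpha> (Suc j)"
    by (simp only: bnb_mass_Suc[OF l'] mult_ac)
  finally show ?case .
qed simp

lemma bnb_mass_sums: 
  assumes "l > 0" shows "bnb_mass l r \<alpha> sums 1"
  using suminf_bnb_mass[OF assms] bnb_mass_pos[OF assms]
  by (intro sums_ennreal[THEN iffD1]) (auto intro: less_imp_le simp: sums_iff)

text \<open>Monotone likelihood ratios imply the stochastic ordering: with the cumulative sums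
  \<open>F, F'\<close> of the two masses, summing the cross products over \<open>i \<le> n < j\<close> gives
  \<open>F' n * (1 - F n) \<le> F n * (1 - F' n)\<close>.\<close>

lemma bnb_cumulative_antimono:
  assumes l: "0 < l" "l \<le> l'"
  shows "(\<Sum>i\<le>n. bnb_mass l' r \<alpha> i) \<le> (\<Sum>i\<le>n. bnb_mass l r \<alpha> i)"
proof -
  define F where "F = (\<Sum>i\<le>n. bnb_mass l r \<alpha> i)"
  define F' where "F' = (\<Sum>i\<le>n. bnb_mass l' r \<alpha> i)"
  have l': "l' > 0" using l by simp
  have tail: "(\<lambda>j. bnb_mass x r \<alpha> (j + Suc n)) sums (1 - (\<Sum>i\<le>n. bnb_mass x r \<alpha> i))" if "x > 0" for x
    using sums_split_initial_segment[OF bnb_mass_sums[OF that], of "Suc n"]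
    by (simp add: lessThan_Suc_atMost)
  have "(\<lambda>j. F' * bnb_mass l r \<alpha> (j + Suc n)) sums (F' * (1 - F))"
    unfolding F_def by (intro sums_mult tail l)
  moreover have "(\<lambda>j. F * bnb_mass l' r \<alpha> (j + Suc n)) sums (F * (1 - F'))"
    unfolding F'_def by (intro sums_mult tail l')
  moreover have "F' * bnb_mass l r \<alpha> (j + Suc n) \<le> F * bnb_mass l' r \<alpha> (j + Suc n)" for j
    unfolding F_def F'_def sum_distrib_right
    by (intro sum_mono bnb_mass_ratio_mono l) auto
  ultimately have "F' * (1 - F) \<le> F * (1 - F')" by (meson sums_le)
  thus ?thesis by (simp add: F_def F'_def algebra_simps)
qed

end

section \<open>The quantile transform\<close>

text \<open>This is the quantile with values in \<open>nat\<close>. It is continued to the intensity \<open>0\<close>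
  by the limiting distribution, the point mass at \<open>0\<close>, so that iterates of the recursion
  may be allowed to converge to \<open>0\<close>.\<close>

definition bnb_count :: "real \<Rightarrow> real \<Rightarrow> real \<Rightarrow> real \<Rightarrow> nat" where
  "bnb_count r \<alpha> l u = (if l \<le> 0 then 0 else LEAST n. u \<le> (\<Sum>i\<le>n. bnb_mass l r \<alpha> i))"

abbreviation unif :: "real measure" where
  "unif \<equiv> uniform_measure lborel {0<..<1}"

lemma prob_space_unif: "prob_space unif"
  by (rule prob_space_uniform_measure) auto

lemma sets_unif [simp, measurable_cong]: "sets unif = sets borel"
  by simp

lemma AE_unif: "AE u in unif. 0 < u \<and> u < 1"
  by (rule AE_uniform_measureI) auto

lemma borel_measurable_Gamma_real [measurable]: "(Gamma :: real \<Rightarrow> real) \<in> borel_measurable borel"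
proof -
  have "(rGamma :: real \<Rightarrow> real) \<in> borel_measurable borel"
    by (intro borel_measurable_continuous_onI continuous_on_rGamma)
  hence "(\<lambda>x::real. inverse (rGamma x)) \<in> borel_measurable borel" by measurable
  thus ?thesis by (simp add: rGamma_inverse_Gamma)
qed

lemma borel_measurable_bnb_mass [measurable]:
  "(\<lambda>l. bnb_mass l r \<alpha> y) \<in> borel_measurable borel"
  unfolding bnb_mass_def Beta_def by measurable

lemma measurable_bnb_count [measurable]:
  assumes [measurable]: "f \<in> borel_measurable N" "g \<in> borel_measurable N"
  shows "(\<lambda>x. bnb_count r \<alpha> (f x) (g x)) \<in> measurable N (count_space UNIV)"
  unfolding bnb_count_def by measurable

lemma bnb_count_0 [simp]: "bnb_count r \<alpha> 0 u = 0"
  by (simp add: bnb_count_def)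

context
  fixes r \<alpha> :: real
  assumes r: "r > 0" and \<alpha>: "\<alpha> > 1"
begin

lemma bnb_cumulative_mono:
  assumes "l > 0" "m \<le> n"
  shows "(\<Sum>i\<le>m. bnb_mass l r \<alpha> i) \<le> (\<Sum>i\<le>n. bnb_mass l r \<alpha> i)"
  using assms bnb_mass_pos[OF r \<alpha> assms(1)] by (intro sum_mono2) (auto intro: less_imp_le)

lemma bnb_cumulative_less_1:
  assumes "l > 0"
  shows "(\<Sum>i\<le>n. bnb_mass l r \<alpha> i) < 1"
  using sum_less_suminf[OF sums_summable[OF bnb_mass_sums[OF r \<alpha> assms]], of "Suc n"]
    bnb_mass_pos[OF r \<alpha> assms] sums_unique[OF bnb_mass_sums[OF r \<alpha> assms]]
  by (simp add: lessThan_Suc_atMost)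

lemma bnb_count_le_iff:
  assumes l: "l > 0" and u: "u < 1"
  shows "bnb_count r \<alpha> l u \<le> n \<longleftrightarrow> u \<le> (\<Sum>i\<le>n. bnb_mass l r \<alpha> i)"
proof -
  have "(\<lambda>n. \<Sum>i\<le>n. bnb_mass l r \<alpha> i) \<longlonglongrightarrow> 1"
    using bnb_mass_sums[OF r \<alpha> l] by (simp add: sums_def_le)
  from order_tendstoD(1)[OF this u] obtain N where N: "u \<le> (\<Sum>i\<le>N. bnb_mass l r \<alpha> i)"
    by (auto simp: eventually_sequentially intro: less_imp_le)
  have eq: "bnb_count r \<alpha> l u = (LEAST n. u \<le> (\<Sum>i\<le>n. bnb_mass l r \<alpha> i))"
    using l by (simp add: bnb_count_def)
  show ?thesis
  proof
    assume "bnb_count r \<alpha> l u \<le> n"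
    thus "u \<le> (\<Sum>i\<le>n. bnb_mass l r \<alpha> i)"
      using LeastI[of "\<lambda>n. u \<le> (\<Sum>i\<le>n. bnb_mass l r \<alpha> i)", OF N] bnb_cumulative_mono[OF l]
      unfolding eq by (meson order_trans)
  qed (simp add: eq Least_le)
qed

lemma bnb_count_mono:
  assumes "0 \<le> l" "l \<le> l'" "u < 1"
  shows "bnb_count r \<alpha> l u \<le> bnb_count r \<alpha> l' u"
proof (cases "l = 0")
  case False
  hence l: "l > 0" "l' > 0" using assms by auto
  have "u \<le> (\<Sum>i\<le>bnb_count r \<alpha> l' u. bnb_mass l' r \<alpha> i)"
    using bnb_count_le_iff[OF l(2) assms(3)] by blast
  also have "\<dots> \<le> (\<Sum>i\<le>bnb_count r \<alpha> l' u. bnb_mass l r \<alpha> i)"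
    by (rule bnb_cumulative_antimono[OF r \<alpha> l(1) assms(2)])
  finally show ?thesis using bnb_count_le_iff[OF l(1) assms(3)] by blast
qed simp

lemma sets_bnb [simp, measurable_cong]: "sets (bnb l r \<alpha>) = UNIV"
  by (simp add: bnb_def)

lemma bnb_cdf_eq:
  assumes "l > 0"
  shows "bnb_cdf l r \<alpha> z = (if z < 0 then 0 else \<Sum>i\<le>nat \<lfloor>z\<rfloor>. bnb_mass l r \<alpha> i)"
proof -
  have "bnb_cdf l r \<alpha> z = measure (bnb l r \<alpha>) {n. real n \<le> z}"
    unfolding bnb_cdf_def cdf_def
    by (subst measure_distr) (auto simp: bnb_def vimage_def)
  also have "{n. real n \<le> z} = (if z < 0 then {} else {..nat \<lfloor>z\<rfloor>})"
    by (auto simp: le_nat_floor) (auto simp: le_floor_iff nat_le_iff le_nat_iff)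
  also have "measure (bnb l r \<alpha>) \<dots> = (if z < 0 then 0 else \<Sum>i\<le>nat \<lfloor>z\<rfloor>. bnb_mass l r \<alpha> i)"
  proof -
    have "emeasure (bnb l r \<alpha>) {..n} = ennreal (\<Sum>i\<le>n. bnb_mass l r \<alpha> i)" for n
      unfolding bnb_def using bnb_mass_pos[OF r \<alpha> assms]
      by (subst emeasure_density)
        (auto simp: nn_integral_count_space_indicator[symmetric] nn_integral_count_space_finite sum_ennreal less_imp_le)
    thus ?thesis using bnb_mass_pos[OF r \<alpha> assms]
      by (auto simp: measure_def enn2real_ennreal sum_nonneg less_imp_le)
  qed
  finally show ?thesis .
qed

text \<open>The distribution function is a step function with jumps at the integers, so the real
  infimum defining the quantile is attained, at the least count whose cumulative sum reaches
  \<open>u\<close>.\<close>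

lemma bnb_quantile_eq_count:
  assumes l: "l > 0" and u: "0 < u" "u < 1"
  shows "bnb_quantile l r \<alpha> u = real (bnb_count r \<alpha> l u)"
proof -
  have "{z. u \<le> bnb_cdf l r \<alpha> z} = {real (bnb_count r \<alpha> l u)..}"
  proof (intro set_eqI)
    fix z
    have "u \<le> bnb_cdf l r \<alpha> z \<longleftrightarrow> z \<ge> 0 \<and> bnb_count r \<alpha> l u \<le> nat \<lfloor>z\<rfloor>"
      using u by (auto simp: bnb_cdf_eq[OF l] bnb_count_le_iff[OF l u(2)])
    also have "\<dots> \<longleftrightarrow> real (bnb_count r \<alpha> l u) \<le> z"
      by (auto simp: le_nat_iff le_floor_iff intro: order_trans[rotated])
    finally show "z \<in> {z. u \<le> bnb_cdf l r \<alpha> z} \<longleftrightarrow> z \<in> {real (bnb_count r \<alpha> l u)..}" by simp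
  qed
  thus ?thesis by (simp add: bnb_quantile_def)
qed

lemma emeasure_bnb_count:
  assumes l: "l > 0"
  shows "emeasure unif {u. bnb_count r \<alpha> l u = k} = ennreal (bnb_mass l r \<alpha> k)"
proof -
  let ?F = "\<lambda>n. \<Sum>i<n. bnb_mass l r \<alpha> i"
  have F1: "?F n < 1" for n
    using bnb_cumulative_less_1[OF l] by (cases n) (simp_all add: lessThan_Suc_atMost)
  have F0: "?F n \<ge> 0" for n
    using bnb_mass_pos[OF r \<alpha> l] by (intro sum_nonneg) (auto intro: less_imp_le)
  have le: "bnb_count r \<alpha> l u < n \<longleftrightarrow> u \<le> ?F n" if "0 < u" "u < 1" for u n
    using bnb_count_le_iff[OF l that(2)] that by (cases n) (simp_all add: lessThan_Suc_atMost less_Suc_eq_le)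
  have "{0<..<1} \<inter> {u. bnb_count r \<alpha> l u = k} = {?F k<..?F (Suc k)}"
  proof (intro set_eqI)
    fix u
    have "bnb_count r \<alpha> l u = k \<longleftrightarrow> \<not> bnb_count r \<alpha> l u < k \<and> bnb_count r \<alpha> l u < Suc k"
      by auto
    thus "u \<in> {0<..<1} \<inter> {u. bnb_count r \<alpha> l u = k} \<longleftrightarrow> u \<in> {?F k<..?F (Suc k)}"
      using le[of u k] le[of u "Suc k"] F1[of "Suc k"] F0[of k] by auto
  qed
  moreover have "{u. bnb_count r \<alpha> l u = k} \<in> sets lborel" by measurable
  ultimately show ?thesis
    using bnb_mass_pos[OF r \<alpha> l, of k] by (subst emeasure_uniform_measure) (auto simp: divide_ennreal_def)
qed

text \<open>The quantile transform of a uniform variable has the prescribed distribution, so moments of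
  the counts can be computed from the masses.\<close>

lemma distr_bnb_count:
  assumes l: "l > 0"
  shows "distr unif (count_space UNIV) (bnb_count r \<alpha> l) = bnb l r \<alpha>"
proof (rule measure_eqI_countable[of _ UNIV])
  fix k
  have "emeasure (distr unif (count_space UNIV) (bnb_count r \<alpha> l)) {k}
      = emeasure unif {u. bnb_count r \<alpha> l u = k}"
    by (subst emeasure_distr) (auto simp: vimage_def)
  thus "emeasure (distr unif (count_space UNIV) (bnb_count r \<alpha> l)) {k} = emeasure (bnb l r \<alpha>) {k}"
    unfolding bnb_def by (subst emeasure_density) (auto simp: emeasure_bnb_count[OF l] nn_integral_count_space_indicator[symmetric] nn_integral_count_space_finite)
qed auto

lemma nn_integral_bnb_count:
  assumes "l \<ge> 0"
  shows "(\<integral>\<^sup>+ u. ennreal (real (bnb_count r \<alpha> l u)) \<partial>unif) = ennreal l"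
proof (cases "l = 0")
  case False
  hence l: "l > 0" using assms by simp
  have "(\<integral>\<^sup>+ u. ennreal (real (bnb_count r \<alpha> l u)) \<partial>unif)
      = (\<integral>\<^sup>+ k. ennreal (real k) \<partial>distr unif (count_space UNIV) (bnb_count r \<alpha> l))"
    by (subst nn_integral_distr) auto
  also have "\<dots> = (\<integral>\<^sup>+ k. ennreal (real k) * ennreal (bnb_mass l r \<alpha> k) \<partial>count_space UNIV)"
    unfolding distr_bnb_count[OF l] bnb_def by (subst nn_integral_density) (auto simp: mult.commute)
  finally show ?thesis
    by (simp add: nn_integral_count_space_nat suminf_bnb_mass_mean[OF r \<alpha> l])
qed simp

text \<open>The quantile coupling is monotone in the intensity, so it realises the difference of the
  means exactly: counts driven by the same uniform variable are as close in mean as their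
  intensities are.\<close>

lemma nn_integral_bnb_count_diff:
  assumes "l \<ge> 0" "l' \<ge> 0"
  shows "(\<integral>\<^sup>+ u. ennreal \<bar>real (bnb_count r \<alpha> l u) - real (bnb_count r \<alpha> l' u)\<bar> \<partial>unif) = ennreal \<bar>l - l'\<bar>"
  using assms
proof (induction l l' rule: linorder_wlog)
  case (le l l')
  let ?Q = "bnb_count r \<alpha>"
  have "ennreal \<bar>real (?Q l u) - real (?Q l' u)\<bar> + ennreal (real (?Q l u)) = ennreal (real (?Q l' u))"
    if "0 < u \<and> u < 1" for u
    using bnb_count_mono[of l l' u] le that by (subst ennreal_plus[symmetric]) auto
  hence "(\<integral>\<^sup>+ u. ennreal \<bar>real (?Q l u) - real (?Q l' u)\<bar> + ennreal (real (?Q l u)) \<partial>unif)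
      = (\<integral>\<^sup>+ u. ennreal (real (?Q l' u)) \<partial>unif)"
    by (intro nn_integral_cong_AE eventually_mono[OF AE_unif])
  hence "(\<integral>\<^sup>+ u. ennreal \<bar>real (?Q l u) - real (?Q l' u)\<bar> \<partial>unif) + ennreal l = ennreal l'"
    using le by (subst (asm) nn_integral_add) (auto simp: nn_integral_bnb_count)
  hence "(\<integral>\<^sup>+ u. ennreal \<bar>real (?Q l u) - real (?Q l' u)\<bar> \<partial>unif) = ennreal l' - ennreal l"
    by (metis ennreal_add_diff_cancel_right ennreal_neq_top)
  thus ?case using le by (simp add: ennreal_minus abs_minus_commute)
next
  case (sym l l')
  thus ?case by (simp add: abs_minus_commute)
qed

end

section \<open>Ergodicity of the Bernoulli shift\<close>

context
  fixes N :: "'b measure"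
  assumes N: "prob_space N"
begin

abbreviation paths :: "(int \<Rightarrow> 'b) measure" where
  "paths \<equiv> Pi\<^sub>M UNIV (\<lambda>_. N)"

lemma prob_space_paths: "prob_space paths"
  using N by (intro prob_space_PiM)

lemma measurable_shift: "(\<lambda>x t. x (t + k)) \<in> measurable paths paths"
  by (rule measurable_PiM_single') (auto simp: space_PiM)

lemma distr_shift: "distr paths paths (\<lambda>x t. x (t + k)) = paths"
  using distr_PiM_reindex[of UNIV "\<lambda>_. N" "\<lambda>t::int. t + k" UNIV] N by (simp add: inj_on_def restrict_def)

lemma measure_shift:
  assumes "A \<in> sets paths"
  shows "measure paths ((\<lambda>x t. x (t + k)) -` A \<inter> space paths) = measure paths A"
proof -
  have "measure (distr paths paths (\<lambda>x t. x (t + k))) A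
      = measure paths ((\<lambda>x t. x (t + k)) -` A \<inter> space paths)"
    using assms by (intro measure_distr measurable_shift)
  thus ?thesis unfolding distr_shift by simp
qed

lemma measure_cylinders_far_apart:
  assumes J: "finite J" "\<And>j. j \<in> J \<Longrightarrow> E j \<in> sets N"
    and K: "finite K" "\<And>j. j \<in> K \<Longrightarrow> F j \<in> sets N"
    and disj: "J \<inter> (\<lambda>j. j + k) ` K = {}"
  defines "C \<equiv> prod_emb UNIV (\<lambda>_. N) J (Pi\<^sub>E J E)" and "D \<equiv> prod_emb UNIV (\<lambda>_. N) K (Pi\<^sub>E K F)"
  shows "measure paths (C \<inter> ((\<lambda>x t. x (t + k)) -` D \<inter> space paths)) = measure paths C * measure paths D"
proof -
  interpret product_prob_space "\<lambda>_::int. N" UNIV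
    by (intro product_prob_spaceI N)
  define K' where "K' = (\<lambda>j. j + k) ` K"
  define E' where "E' = (\<lambda>j. if j \<in> J then E j else F (j - k))"
  have E': "E' j \<in> sets N" if "j \<in> J \<union> K'" for j
    using that J K by (auto simp: E'_def K'_def)
  have "C \<inter> ((\<lambda>x t. x (t + k)) -` D \<inter> space paths) = prod_emb UNIV (\<lambda>_. N) (J \<union> K') (Pi\<^sub>E (J \<union> K') E')"
  proof -
    have "E' (j + k) = F j" if "j \<in> K" for j
      using disj that by (auto simp: E'_def)
    hence "(\<forall>j\<in>J \<union> K'. x j \<in> E' j) \<longleftrightarrow> (\<forall>j\<in>J. x j \<in> E j) \<and> (\<forall>j\<in>K. x (j + k) \<in> F j)" for x
      by (simp add: ball_Un K'_def) (simp add: E'_def)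
    thus ?thesis
      by (auto simp: C_def D_def prod_emb_def space_PiM PiE_iff)
  qed
  hence "measure paths (C \<inter> ((\<lambda>x t. x (t + k)) -` D \<inter> space paths)) = (\<Prod>j\<in>J \<union> K'. measure N (E' j))"
    using J(1) K(1) E' by (simp only: measure_PiM_emb finite_Un K'_def finite_imageI subset_UNIV)
  also have "\<dots> = (\<Prod>j\<in>J. measure N (E' j)) * (\<Prod>j\<in>K'. measure N (E' j))"
    using J K disj by (intro prod.union_disjoint) (auto simp: K'_def)
  also have "(\<Prod>j\<in>J. measure N (E' j)) = (\<Prod>j\<in>J. measure N (E j))"
    by (simp add: E'_def)
  also have "(\<Prod>j\<in>K'. measure N (E' j)) = (\<Prod>j\<in>K. measure N (E' (j + k)))"
    unfolding K'_def by (subst prod.reindex) auto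
  also have "\<dots> = (\<Prod>j\<in>K. measure N (F j))"
    using disj by (intro prod.cong) (auto simp: E'_def)
  finally show ?thesis
    using J K by (simp add: C_def D_def measure_PiM_emb)
qed

text \<open>Mixing holds for cylinders because their coordinates become disjoint, and the sets for
  which it holds form a Dynkin system: for a disjoint union the limit may be taken under the
  sum.\<close>

lemma shift_mixing:
  assumes A: "A \<in> sets paths" and K: "finite K" "\<And>j. j \<in> K \<Longrightarrow> F j \<in> sets N"
  defines "D \<equiv> prod_emb UNIV (\<lambda>_. N) K (Pi\<^sub>E K F)"
  shows "(\<lambda>k. measure paths (A \<inter> ((\<lambda>x t. x (t + int k)) -` D \<inter> space paths)))
    \<longlonglongrightarrow> measure paths A * measure paths D"
proof -
  interpret prob_space paths by (rule prob_space_paths)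
  have D: "D \<in> sets paths" unfolding D_def using K by (intro sets_PiM_I) auto
  define T where "T k = (\<lambda>x t. x (t + int k)) -` D \<inter> space paths" for k
  have T: "T k \<in> sets paths" for k
    unfolding T_def using D by (intro measurable_sets[OF measurable_shift])
  have prob_T: "prob (T k) = prob D" for k
    unfolding T_def by (rule measure_shift[OF D])
  have A': "A \<in> sigma_sets (space paths) (prod_algebra UNIV (\<lambda>_. N))"
    using A by (simp add: sets_PiM space_PiM)
  have closed: "prod_algebra UNIV (\<lambda>_::int. N) \<subseteq> Pow (space paths)"
    using prod_algebra_sets_into_space by (simp add: space_PiM)
  from Int_stable_prod_algebra closed A' have "(\<lambda>k. prob (A \<inter> T k)) \<longlonglongrightarrow> prob A * prob D"
  proof (induction rule: sigma_sets_induct_disjoint)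
    case (basic A)
    then obtain J E where A: "A = prod_emb UNIV (\<lambda>_. N) J (Pi\<^sub>E J E)"
      and J: "finite J" "\<And>j. j \<in> J \<Longrightarrow> E j \<in> sets N"
      by (auto elim!: prod_algebraE)
    have "{k. J \<inter> (\<lambda>j. j + int k) ` K \<noteq> {}} \<subseteq> (\<lambda>(i, j). nat (i - j)) ` (J \<times> K)"
      by (force simp: image_iff)
    \<comment> \<open>Only finitely many shifts let the two sets of coordinates meet.\<close>
    hence "finite {k. J \<inter> (\<lambda>j. j + int k) ` K \<noteq> {}}"
      by (rule finite_subset) (use J K in auto)
    hence "eventually (\<lambda>k. J \<inter> (\<lambda>j. j + int k) ` K = {}) sequentially"
      by (simp add: cofinite_eq_sequentially[symmetric] eventually_cofinite)
    hence "eventually (\<lambda>k. prob (A \<inter> T k) = prob A * prob D) sequentially"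
      by eventually_elim (unfold A T_def D_def, rule measure_cylinders_far_apart[OF J K])
    thus ?case by (rule tendsto_eventually)
  next
    case (compl A)
    hence A: "A \<in> sets paths" by (simp add: sets_PiM space_PiM)
    have "prob ((space paths - A) \<inter> T k) = prob D - prob (A \<inter> T k)" for k
    proof -
      have "(space paths - A) \<inter> T k = T k - A \<inter> T k" by (auto simp: T_def)
      thus ?thesis using A T[of k] prob_T[of k]
        by (simp add: finite_measure_Diff sets.Int)
    qed
    moreover have "prob (space paths - A) * prob D = prob D - prob A * prob D"
      using A by (simp add: prob_compl algebra_simps)
    ultimately show ?case using compl(2) by (auto intro!: tendsto_intros)
  next
    case (union A)
    hence A: "A i \<in> sets paths" for i by (auto simp: sets_PiM space_PiM)
    have sum_T: "prob ((\<Union>i. A i) \<inter> T k) = (\<Sum>i. prob (A i \<inter> T k))" for k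
    proof -
      have "(\<lambda>i. prob (A i \<inter> T k)) sums prob (\<Union>i. A i \<inter> T k)"
        using A T union(1) by (intro finite_measure_UNION) (auto 0 3 simp: disjoint_family_on_def)
      thus ?thesis by (simp add: sums_iff)
    qed
    have sum_A: "(\<lambda>i. prob (A i)) sums prob (\<Union>i. A i)"
      using A union(1) by (intro finite_measure_UNION) auto
    have "(\<lambda>k. \<Sum>i. prob (A i \<inter> T k)) \<longlonglongrightarrow> (\<Sum>i. prob (A i) * prob D)"
    proof -
      have "eventually (\<lambda>(i,k). norm (prob (A i \<inter> T k)) \<le> prob (A i)) (at_top \<times>\<^sub>F sequentially)"
        using A T by (intro always_eventually) (auto intro!: finite_measure_mono)
      from tannerys_theorem[OF union(3) this] sum_A show ?thesis by (auto simp: sums_iff)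
    qed
    also have "(\<Sum>i. prob (A i) * prob D) = prob (\<Union>i. A i) * prob D"
      using sums_mult2[OF sum_A, of "prob D"] by (simp add: sums_iff)
    finally show ?case unfolding sum_T .
  qed (auto simp: space_PiM prod_algebra_sets_into_space)
  thus ?thesis unfolding T_def .
qed

text \<open>Mixing determines the measure of \<open>A \<inter> D\<close> for invariant \<open>A\<close> and every cylinder
  \<open>D\<close>, since shifting \<open>D\<close> does not change it. So \<open>A\<close> is independent of all
  cylinders, hence of every measurable set, and in particular of itself.\<close>

theorem shift_ergodic:
  assumes A: "A \<in> sets paths" and inv: "(\<lambda>x t. x (t + 1)) -` A \<inter> space paths = A"
  shows "measure paths A \<in> {0, 1}"
proof -
  interpret prob_space paths by (rule prob_space_paths)
  have inv_k: "(\<lambda>x t. x (t + int k)) -` A \<inter> space paths = A" for k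
  proof (induction k)
    case 0
    thus ?case using sets.sets_into_space[OF A] by auto
  next
    case (Suc k)
    have "(\<lambda>x t. x (t + int (Suc k))) -` A \<inter> space paths
        = (\<lambda>x t. x (t + 1)) -` ((\<lambda>x t. x (t + int k)) -` A \<inter> space paths) \<inter> space paths"
      by (auto simp: add_ac space_PiM)
    thus ?case unfolding Suc inv .
  qed
  have indep: "prob (A \<inter> D) = prob A * prob D" if D: "D \<in> prod_algebra UNIV (\<lambda>_. N)" for D
  proof -
    obtain K F where DK: "D = prod_emb UNIV (\<lambda>_. N) K (Pi\<^sub>E K F)"
      and K: "finite K" "\<And>j. j \<in> K \<Longrightarrow> F j \<in> sets N"
      using D by (auto elim!: prod_algebraE)
    have Ds: "D \<in> sets paths" unfolding DK using K by (intro sets_PiM_I) auto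
    have "prob (A \<inter> ((\<lambda>x t. x (t + int k)) -` D \<inter> space paths)) = prob (A \<inter> D)" for k
    proof -
      have "A \<inter> ((\<lambda>x t. x (t + int k)) -` D \<inter> space paths)
          = (\<lambda>x t. x (t + int k)) -` (A \<inter> D) \<inter> space paths"
        using inv_k[of k] by auto
      thus ?thesis by (simp only: measure_shift[OF sets.Int[OF A Ds]])
    qed
    with shift_mixing[OF A K(1), of F] K(2) have "(\<lambda>_::nat. prob (A \<inter> D)) \<longlonglongrightarrow> prob A * prob D"
      unfolding DK by simp
    thus ?thesis by (simp add: LIMSEQ_const_iff)
  qed
  have sets: "sets paths = sigma_sets (space paths) (prod_algebra UNIV (\<lambda>_. N))"
    by (simp add: sets_PiM space_PiM)
  have "indep_set {A} (prod_algebra UNIV (\<lambda>_. N))"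
    using A indep by (auto simp: indep_sets2_eq sets intro: sigma_sets.Basic)
  hence "indep_set (sigma_sets (space paths) {A}) (sets paths)"
    unfolding sets by (intro indep_set_sigma_sets Int_stable_prod_algebra) (auto simp: Int_stable_def)
  hence "prob (A \<inter> A) = prob A * prob A"
    by (rule indep_setD) (use A in auto)
  hence "prob A * (prob A - 1) = 0" by (simp add: algebra_simps)
  thus ?thesis by simp
qed

end

section \<open>Independent uniform driving variables\<close>

lemma distr_iid_uniform:
  fixes \<sigma> :: "'i \<Rightarrow> int"
  assumes "prob_space M" "iid_uniform M u" "inj \<sigma>"
  shows "distr M (Pi\<^sub>M UNIV (\<lambda>_. borel)) (\<lambda>\<omega> i. u (\<sigma> i) \<omega>) = Pi\<^sub>M UNIV (\<lambda>_. unif)"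
proof -
  interpret prob_space M by fact
  have indep: "indep_vars (\<lambda>_. borel) u UNIV" and unif: "\<And>t. distr M borel (u t) = unif"
    using assms(2) by (auto simp: iid_uniform_def)
  have [measurable]: "u t \<in> borel_measurable M" for t
    using indep by (auto simp: indep_vars_def)
  have sets: "sets (Pi\<^sub>M UNIV (\<lambda>_::'k. unif)) = sets (Pi\<^sub>M UNIV (\<lambda>_::'k. borel :: real measure))"
    for dummy :: 'k by (intro sets_PiM_cong) auto
  have "distr M (Pi\<^sub>M UNIV (\<lambda>_. borel)) (\<lambda>\<omega>. \<lambda>i\<in>UNIV. u i \<omega>) = Pi\<^sub>M UNIV (\<lambda>i. distr M borel (u i))"
    using indep by (subst (asm) indep_vars_iff_distr_eq_PiM') auto
  hence all: "distr M (Pi\<^sub>M UNIV (\<lambda>_. borel)) (\<lambda>\<omega> i. u i \<omega>) = Pi\<^sub>M UNIV (\<lambda>_. unif)"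
    by (simp add: unif restrict_def)
  have "Pi\<^sub>M UNIV (\<lambda>_. unif) = distr (Pi\<^sub>M UNIV (\<lambda>_. unif)) (Pi\<^sub>M UNIV (\<lambda>_. unif)) (\<lambda>x i. x (\<sigma> i))"
    using distr_PiM_reindex[of UNIV "\<lambda>_. unif" \<sigma> UNIV] prob_space_unif assms(3)
    by (simp add: restrict_def)
  also have "\<dots> = distr (Pi\<^sub>M UNIV (\<lambda>_. unif)) (Pi\<^sub>M UNIV (\<lambda>_. borel)) (\<lambda>x i. x (\<sigma> i))"
    by (intro distr_cong) (auto simp: sets)
  also have "\<dots> = distr M (Pi\<^sub>M UNIV (\<lambda>_. borel)) ((\<lambda>x i. x (\<sigma> i)) \<circ> (\<lambda>\<omega> i. u i \<omega>))"
    unfolding all[symmetric] by (intro distr_distr) (auto intro!: measurable_PiM_single')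
  finally show ?thesis by (simp add: comp_def)
qed

abbreviation unifs :: "(nat \<Rightarrow> real) measure" where
  "unifs \<equiv> Pi\<^sub>M UNIV (\<lambda>_. unif)"

lemma sets_unifs: "sets unifs = sets (Pi\<^sub>M UNIV (\<lambda>_. borel))"
  by (intro sets_PiM_cong) auto

lemma space_unifs [simp]: "space unifs = UNIV"
  by (simp add: space_PiM)

lemma prob_space_unifs: "prob_space unifs"
  by (intro prob_space_PiM prob_space_unif)

lemma measurable_tail:
  "(\<lambda>w i. w (Suc i)) \<in> measurable (Pi\<^sub>M UNIV (\<lambda>_::nat. N)) (Pi\<^sub>M UNIV (\<lambda>_. N))"
  by (rule measurable_PiM_single') (auto simp: space_PiM)

text \<open>A sequence of independent uniform variables is an independent pair of its head and its tail.
  With the innovations listed backwards in time, the head is the newest one and the tail is the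
  past on which the current intensity depends.\<close>

lemma nn_integral_unifs_split:
  assumes [measurable]: "(\<lambda>(v, w). \<phi> v w) \<in> borel_measurable (borel \<Otimes>\<^sub>M Pi\<^sub>M UNIV (\<lambda>_. borel))"
  shows "(\<integral>\<^sup>+ w. \<phi> (w 0) (\<lambda>i. w (Suc i)) \<partial>unifs) = (\<integral>\<^sup>+ w. \<integral>\<^sup>+ v. \<phi> v w \<partial>unif \<partial>unifs)"
proof -
  interpret sequence_space unif
    unfolding sequence_space_def by (intro product_prob_spaceI prob_space_unif)
  interpret pair_sigma_finite unif unifs
    using prob_space_unif prob_space_unifs
    by (intro pair_sigma_finite.intro prob_space_imp_sigma_finite)
  have "(\<integral>\<^sup>+ w. \<phi> (w 0) (\<lambda>i. w (Suc i)) \<partial>unifs)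
      = (\<integral>\<^sup>+ w. \<phi> (w 0) (\<lambda>i. w (Suc i)) \<partial>distr (unif \<Otimes>\<^sub>M unifs) unifs (\<lambda>(s, \<omega>). case_nat s \<omega>))"
    by (simp only: PiM_iter)
  also have "\<dots> = (\<integral>\<^sup>+ z. \<phi> (fst z) (snd z) \<partial>(unif \<Otimes>\<^sub>M unifs))"
  proof -
    have "(\<lambda>w. (w 0, \<lambda>i. w (Suc i))) \<in> measurable unifs (unif \<Otimes>\<^sub>M unifs)"
      by (intro measurable_Pair measurable_tail measurable_component_singleton) simp
    hence "(\<lambda>w. (w 0, \<lambda>i. w (Suc i))) \<in> measurable unifs (borel \<Otimes>\<^sub>M Pi\<^sub>M UNIV (\<lambda>_. borel))"
      by (simp only: measurable_cong_sets[OF refl sets_pair_measure_cong[OF sets_unif sets_unifs]])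
    from measurable_compose[OF this assms]
    have "(\<lambda>w. \<phi> (w 0) (\<lambda>i. w (Suc i))) \<in> borel_measurable unifs" by simp
    moreover have "(\<lambda>(s, \<omega>). case_nat s \<omega>) \<in> measurable (unif \<Otimes>\<^sub>M unifs) unifs"
      by measurable
    ultimately show ?thesis by (subst nn_integral_distr) (simp_all add: split_beta')
  qed
  also have "\<dots> = (\<integral>\<^sup>+ w. \<integral>\<^sup>+ v. \<phi> v w \<partial>unif \<partial>unifs)"
    using assms by (subst nn_integral_snd[symmetric]) (simp_all add: split_beta')
  finally show ?thesis .
qed

lemma ennreal_le_add:
  assumes "x \<le> y + z" "y \<ge> 0" "z \<ge> 0"
  shows "ennreal x \<le> ennreal y + ennreal z"
  using assms by (metis ennreal_leI ennreal_plus)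

section \<open>The contraction on the half line\<close>

text \<open>The constant \<open>a\<close> is the value that continues \<open>G 0\<close> to the intensity \<open>0\<close>. Its
  positivity makes \<open>0\<close> a state that is left at once. At intensity \<open>0\<close> the count is
  \<open>0\<close>, which is why it is \<open>G 0\<close> that matters there.\<close>

locale bnb_contraction =
  fixes r \<alpha> c1 c2 a :: real and G :: "nat \<Rightarrow> real \<Rightarrow> real"
  assumes r: "r > 0" and \<alpha>: "\<alpha> > 1"
    and G_pos: "l > 0 \<Longrightarrow> G y l > 0"
    and c1: "c1 > 0" and c2: "c2 > 0" and c12: "c1 + c2 < 1"
    and lipschitz: "l > 0 \<Longrightarrow> l' > 0 \<Longrightarrow> \<bar>G y l - G y' l'\<bar> \<le> c1 * \<bar>real y - real y'\<bar> + c2 * \<bar>l - l'\<bar>"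
    and a_pos: "a > 0" and G_0: "(G 0 \<longlongrightarrow> a) (at_right 0)"
begin

text \<open>The map \<open>link\<close> extends \<open>G\<close> to all states that can occur with a nonnegative intensity,
  and \<open>step\<close> is the resulting random map on the closed half line, driven by a uniform
  variable. The closed half line is needed since the limit of the backward iteration is only
  known to be nonnegative at first.\<close>

definition link :: "nat \<Rightarrow> real \<Rightarrow> real" where
  "link y l = (if l > 0 then G y l else a)"

definition step :: "real \<Rightarrow> real \<Rightarrow> real" where
  "step v l = link (bnb_count r \<alpha> l v) l"

lemma link_pos: "link y l > 0"
  using G_pos a_pos by (simp add: link_def)

lemma step_pos: "step v l > 0"
  by (simp add: step_def link_pos)

lemma link_lipschitz_0:
  assumes "l > 0"
  shows "\<bar>a - G y l\<bar> \<le> c1 * real y + c2 * l"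
proof (rule tendsto_le[OF trivial_limit_at_right_real])
  show "((\<lambda>e. \<bar>G 0 e - G y l\<bar>) \<longlongrightarrow> \<bar>a - G y l\<bar>) (at_right 0)"
    by (intro tendsto_intros G_0)
  have "((\<lambda>e. c1 * real y + c2 * \<bar>e - l\<bar>) \<longlongrightarrow> c1 * real y + c2 * \<bar>0 - l\<bar>) (at_right 0)"
    by (intro tendsto_intros)
  thus "((\<lambda>e. c1 * real y + c2 * \<bar>e - l\<bar>) \<longlongrightarrow> c1 * real y + c2 * l) (at_right 0)"
    using assms by simp
  show "eventually (\<lambda>e. \<bar>G 0 e - G y l\<bar> \<le> c1 * real y + c2 * \<bar>e - l\<bar>) (at_right 0)"
    using eventually_at_right_less by eventually_elim (use lipschitz[OF _ assms, of _ 0 y] in simp)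
qed

text \<open>The extended map keeps the Lipschitz bound on the states that occur, which are those with a
  positive intensity and the single state with intensity and count \<open>0\<close>.\<close>

lemma link_lipschitz:
  assumes "l > 0 \<or> l = 0 \<and> y = 0" "l' > 0 \<or> l' = 0 \<and> y' = 0"
  shows "\<bar>link y l - link y' l'\<bar> \<le> c1 * \<bar>real y - real y'\<bar> + c2 * \<bar>l - l'\<bar>"
  using assms lipschitz[of l l' y y'] link_lipschitz_0[of l y] link_lipschitz_0[of l' y']
  by (auto simp: link_def abs_minus_commute)

lemma measurable_link [measurable]:
  assumes y: "y \<in> measurable N (count_space UNIV)" and l: "l \<in> borel_measurable N"
  shows "(\<lambda>x. link (y x) (l x)) \<in> borel_measurable N"
proof (rule measurable_compose_countable[OF _ y])
  fix k
  have "continuous_on {0<..} (G k)"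
  proof (rule continuous_on_iff[THEN iffD2], intro ballI allI impI)
    fix x e :: real assume x: "x \<in> {0<..}" and e: "e > 0"
    show "\<exists>d>0. \<forall>x'\<in>{0<..}. dist x' x < d \<longrightarrow> dist (G k x') (G k x) < e"
    proof (intro exI[of _ e] conjI ballI impI e)
      fix x' assume x': "x' \<in> {0<..}" "dist x' x < e"
      have "\<bar>G k x' - G k x\<bar> \<le> c2 * \<bar>x' - x\<bar>"
        using lipschitz[of x' x k k] x x' by simp
      also have "\<dots> \<le> 1 * \<bar>x' - x\<bar>"
        using c1 c12 by (intro mult_right_mono) auto
      finally show "dist (G k x') (G k x) < e" using x' by (simp add: dist_real_def)
    qed
  qed
  hence "G k \<in> borel_measurable (restrict_space borel {0<..})"
    by (rule borel_measurable_continuous_on_restrict)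
  hence "G k \<in> borel_measurable (restrict_space borel {x. x > 0})"
    by (simp only: greaterThan_def)
  moreover have "(\<lambda>_. a) \<in> borel_measurable (restrict_space borel {x::real. \<not> x > 0})"
    by (rule measurable_const) simp
  moreover have "Measurable.pred borel (\<lambda>x::real. x > 0)"
    by measurable
  ultimately have "link k \<in> borel_measurable borel"
    unfolding link_def[abs_def] by (subst measurable_If_restrict_space_iff) simp_all
  from measurable_compose[OF l this] show "(\<lambda>x. link k (l x)) \<in> borel_measurable N" .
qed

lemma measurable_step [measurable]:
  assumes [measurable]: "v \<in> borel_measurable N" "l \<in> borel_measurable N"
  shows "(\<lambda>x. step (v x) (l x)) \<in> borel_measurable N"
  unfolding step_def by measurable

lemma measurable_step_tail:
  assumes "h \<in> borel_measurable (Pi\<^sub>M UNIV (\<lambda>_. borel))"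
  shows "(\<lambda>w. step (w 0) (h (\<lambda>i. w (Suc i)))) \<in> borel_measurable (Pi\<^sub>M UNIV (\<lambda>_. borel))"
  by (intro measurable_step measurable_component_singleton measurable_compose[OF measurable_tail assms]) simp

text \<open>This is the contraction behind existence and uniqueness. It holds in mean only: for a fixed
  \<open>v\<close> the map \<open>step v\<close> may jump where the count does.\<close>

lemma nn_integral_step_diff:
  assumes l: "l \<ge> 0" "l' \<ge> 0"
  shows "(\<integral>\<^sup>+ v. ennreal \<bar>step v l - step v l'\<bar> \<partial>unif) \<le> ennreal (c1 + c2) * ennreal \<bar>l - l'\<bar>"
proof -
  let ?Q = "bnb_count r \<alpha>"
  have "ennreal \<bar>step v l - step v l'\<bar>
      \<le> ennreal c1 * ennreal \<bar>real (?Q l v) - real (?Q l' v)\<bar> + ennreal (c2 * \<bar>l - l'\<bar>)" for v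
  proof -
    have "\<bar>step v l - step v l'\<bar> \<le> c1 * \<bar>real (?Q l v) - real (?Q l' v)\<bar> + c2 * \<bar>l - l'\<bar>"
      unfolding step_def using l by (intro link_lipschitz) (auto simp: bnb_count_def)
    thus ?thesis
      using c1 c2 by (subst ennreal_mult'[symmetric]) (auto intro!: ennreal_le_add)
  qed
  hence "(\<integral>\<^sup>+ v. ennreal \<bar>step v l - step v l'\<bar> \<partial>unif)
      \<le> (\<integral>\<^sup>+ v. ennreal c1 * ennreal \<bar>real (?Q l v) - real (?Q l' v)\<bar> + ennreal (c2 * \<bar>l - l'\<bar>) \<partial>unif)"
    by (intro nn_integral_mono)
  also have "\<dots> = ennreal c1 * ennreal \<bar>l - l'\<bar> + ennreal (c2 * \<bar>l - l'\<bar>)"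
    using prob_space.emeasure_space_1[OF prob_space_unif]
    by (subst nn_integral_add) (auto simp: nn_integral_cmult nn_integral_bnb_count_diff[OF r \<alpha> l])
  also have "\<dots> = ennreal (c1 + c2) * ennreal \<bar>l - l'\<bar>"
    using c1 c2 by (simp add: ennreal_mult' ennreal_plus distrib_right)
  finally show ?thesis .
qed

lemma nn_integral_step_unifs_diff:
  assumes [measurable]: "h \<in> borel_measurable (Pi\<^sub>M UNIV (\<lambda>_. borel))" "h' \<in> borel_measurable (Pi\<^sub>M UNIV (\<lambda>_. borel))"
    and nonneg: "\<And>w. h w \<ge> 0" "\<And>w. h' w \<ge> 0"
  shows "(\<integral>\<^sup>+ w. ennreal \<bar>step (w 0) (h (\<lambda>i. w (Suc i))) - step (w 0) (h' (\<lambda>i. w (Suc i)))\<bar> \<partial>unifs)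
    \<le> ennreal (c1 + c2) * (\<integral>\<^sup>+ w. ennreal \<bar>h w - h' w\<bar> \<partial>unifs)"
proof -
  have "(\<integral>\<^sup>+ w. ennreal \<bar>step (w 0) (h (\<lambda>i. w (Suc i))) - step (w 0) (h' (\<lambda>i. w (Suc i)))\<bar> \<partial>unifs)
      = (\<integral>\<^sup>+ w. \<integral>\<^sup>+ v. ennreal \<bar>step v (h w) - step v (h' w)\<bar> \<partial>unif \<partial>unifs)"
    by (rule nn_integral_unifs_split) (simp add: split_beta')
  also have "\<dots> \<le> (\<integral>\<^sup>+ w. ennreal (c1 + c2) * ennreal \<bar>h w - h' w\<bar> \<partial>unifs)"
    by (intro nn_integral_mono nn_integral_step_diff nonneg)
  also have "\<dots> = ennreal (c1 + c2) * (\<integral>\<^sup>+ w. ennreal \<bar>h w - h' w\<bar> \<partial>unifs)"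
    by (intro nn_integral_cmult) measurable
  finally show ?thesis .
qed

section \<open>Backward iteration\<close>

text \<open>The intensity obtained by starting \<open>m\<close> steps ago in the state \<open>0\<close>, where \<open>w i\<close>
  is the innovation \<open>i + 1\<close> steps ago.\<close>

primrec approx :: "nat \<Rightarrow> (nat \<Rightarrow> real) \<Rightarrow> real" where
  "approx 0 w = 0"
| "approx (Suc m) w = step (w 0) (approx m (\<lambda>i. w (Suc i)))"

lemma approx_nonneg: "approx m w \<ge> 0"
  by (cases m) (auto intro: less_imp_le step_pos)

lemma measurable_approx [measurable]: "approx m \<in> borel_measurable (Pi\<^sub>M UNIV (\<lambda>_. borel))"
proof (induction m)
  case (Suc m)
  thus ?case by (simp add: measurable_step_tail)
qed simp

abbreviation \<kappa> :: real where "\<kappa> \<equiv> c1 + c2"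

lemma \<kappa>: "0 < \<kappa>" "\<kappa> < 1"
  using c1 c2 c12 by auto

lemma nn_integral_approx_Suc_diff:
  "(\<integral>\<^sup>+ w. ennreal \<bar>approx (Suc m) w - approx m w\<bar> \<partial>unifs) \<le> ennreal (\<kappa> ^ m * a)"
proof (induction m)
  case 0
  have "ennreal \<bar>approx (Suc 0) w - approx 0 w\<bar> = ennreal a" for w
    using a_pos by (simp add: step_def link_def)
  thus ?case using prob_space.emeasure_space_1[OF prob_space_unifs] by simp
next
  case (Suc m)
  have "(\<integral>\<^sup>+ w. ennreal \<bar>approx (Suc (Suc m)) w - approx (Suc m) w\<bar> \<partial>unifs)
      \<le> ennreal \<kappa> * (\<integral>\<^sup>+ w. ennreal \<bar>approx (Suc m) w - approx m w\<bar> \<partial>unifs)"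
    using nn_integral_step_unifs_diff[OF measurable_approx measurable_approx approx_nonneg approx_nonneg, of "Suc m" m]
    by simp
  also have "\<dots> \<le> ennreal \<kappa> * ennreal (\<kappa> ^ m * a)"
    by (intro mult_left_mono Suc) simp
  also have "\<dots> = ennreal (\<kappa> ^ Suc m * a)"
    using \<kappa> by (simp add: ennreal_mult'[symmetric] mult.assoc)
  finally show ?case .
qed

text \<open>The truncation at \<open>0\<close> fixes the sign on the null set where the iteration diverges, so
  that \<open>limit\<close> is nonnegative everywhere.\<close>

definition limit :: "(nat \<Rightarrow> real) \<Rightarrow> real" where
  "limit w = max 0 (lim (\<lambda>m. approx m w))"

lemma limit_nonneg: "limit w \<ge> 0"
  by (simp add: limit_def)

lemma measurable_limit [measurable]: "limit \<in> borel_measurable (Pi\<^sub>M UNIV (\<lambda>_. borel))"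
  unfolding limit_def[abs_def] by measurable

lemma nn_integral_approx_tail:
  "(\<integral>\<^sup>+ w. (\<Sum>j. ennreal \<bar>approx (Suc (j + m)) w - approx (j + m) w\<bar>) \<partial>unifs)
    \<le> ennreal (\<kappa> ^ m * a / (1 - \<kappa>))"
proof -
  have "(\<integral>\<^sup>+ w. (\<Sum>j. ennreal \<bar>approx (Suc (j + m)) w - approx (j + m) w\<bar>) \<partial>unifs)
      = (\<Sum>j. \<integral>\<^sup>+ w. ennreal \<bar>approx (Suc (j + m)) w - approx (j + m) w\<bar> \<partial>unifs)"
    by (intro nn_integral_suminf) measurable
  also have "\<dots> \<le> (\<Sum>j. ennreal (\<kappa> ^ (j + m) * a))"
    by (intro suminf_le nn_integral_approx_Suc_diff) auto
  also have "\<dots> = ennreal (\<kappa> ^ m * a / (1 - \<kappa>))"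
  proof -
    have "(\<lambda>j. \<kappa> ^ j * (\<kappa> ^ m * a)) sums (1 / (1 - \<kappa>) * (\<kappa> ^ m * a))"
      using \<kappa> by (intro sums_mult2 geometric_sums) auto
    thus ?thesis using \<kappa> a_pos
      by (intro suminf_ennreal_eq) (auto simp: power_add mult_ac)
  qed
  finally show ?thesis .
qed

text \<open>The increments of the iteration have means bounded by a geometric sequence. Hence their sum is
  finite almost surely, the iteration converges, and the remainder is bounded by the tail of the
  sum.\<close>

lemma AE_limit:
  "AE w in unifs. \<forall>m. ennreal \<bar>limit w - approx m w\<bar>
     \<le> (\<Sum>j. ennreal \<bar>approx (Suc (j + m)) w - approx (j + m) w\<bar>)"
proof -
  have "AE w in unifs. (\<Sum>j. ennreal \<bar>approx (Suc (j + 0)) w - approx (j + 0) w\<bar>) \<noteq> \<infinity>"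
  proof (rule nn_integral_PInf_AE)
    show "(\<integral>\<^sup>+ w. (\<Sum>j. ennreal \<bar>approx (Suc (j + 0)) w - approx (j + 0) w\<bar>) \<partial>unifs) \<noteq> \<infinity>"
      using nn_integral_approx_tail[of 0] by (auto simp: top_unique)
  qed measurable
  thus ?thesis
  proof eventually_elim
    case (elim w)
    let ?d = "\<lambda>j. approx (Suc j) w - approx j w"
    have abs: "summable (\<lambda>j. \<bar>?d j\<bar>)"
      using elim by (intro summable_suminf_not_top) (auto simp: top_unique)
    hence summ: "summable ?d" by (rule summable_rabs_cancel)
    have "(\<lambda>m. \<Sum>j<m. ?d j) \<longlonglongrightarrow> suminf ?d"
      using summable_LIMSEQ[OF summ] .
    hence conv: "(\<lambda>m. approx m w) \<longlonglongrightarrow> suminf ?d"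
      by (simp only: sum_lessThan_telescope[of "\<lambda>j. approx j w"] approx.simps(1) diff_0_right)
    have "suminf ?d \<ge> 0"
      by (rule LIMSEQ_le_const[OF conv]) (auto intro: approx_nonneg)
    hence lim: "limit w = suminf ?d"
      using limI[OF conv] by (simp add: limit_def)
    show ?case
    proof
      fix m
      have "(\<Sum>j<m. ?d j) = approx m w"
        by (simp only: sum_lessThan_telescope[of "\<lambda>j. approx j w"] approx.simps(1) diff_0_right)
      hence eq: "limit w - approx m w = (\<Sum>j. ?d (j + m))"
        unfolding lim using suminf_split_initial_segment[OF summ, of m] by simp
      have "ennreal \<bar>limit w - approx m w\<bar> \<le> ennreal (\<Sum>j. \<bar>?d (j + m)\<bar>)"
        unfolding eq
        by (intro ennreal_leI summable_rabs summable_ignore_initial_segment[of "\<lambda>j. \<bar>?d j\<bar>" m] abs)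
      also have "\<dots> = (\<Sum>j. ennreal \<bar>?d (j + m)\<bar>)"
        by (rule suminf_ennreal2[OF abs_ge_zero summable_ignore_initial_segment[OF abs], symmetric])
      finally show "ennreal \<bar>limit w - approx m w\<bar>
         \<le> (\<Sum>j. ennreal \<bar>approx (Suc (j + m)) w - approx (j + m) w\<bar>)" by simp
    qed
  qed
qed

lemma nn_integral_limit_diff:
  "(\<integral>\<^sup>+ w. ennreal \<bar>limit w - approx m w\<bar> \<partial>unifs) \<le> ennreal (\<kappa> ^ m * a / (1 - \<kappa>))"
proof -
  have "(\<integral>\<^sup>+ w. ennreal \<bar>limit w - approx m w\<bar> \<partial>unifs)
      \<le> (\<integral>\<^sup>+ w. (\<Sum>j. ennreal \<bar>approx (Suc (j + m)) w - approx (j + m) w\<bar>) \<partial>unifs)"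
    by (intro nn_integral_mono_AE eventually_mono[OF AE_limit]) blast
  thus ?thesis using nn_integral_approx_tail by (rule order_trans)
qed

lemma nn_integral_limit_finite: "(\<integral>\<^sup>+ w. ennreal (limit w) \<partial>unifs) < \<infinity>"
  using nn_integral_limit_diff[of 0] limit_nonneg by (simp add: le_less_trans[OF _ ennreal_less_top])

text \<open>Passing to the limit in the recursion is not immediate since \<open>step v\<close> is in general discontinuous.
  The contraction in mean replaces continuity: both sides are close in mean to the same
  approximation.\<close>

lemma AE_limit_step: "AE w in unifs. limit w = step (w 0) (limit (\<lambda>i. w (Suc i)))"
proof -
  let ?D = "\<lambda>w. ennreal \<bar>limit w - step (w 0) (limit (\<lambda>i. w (Suc i)))\<bar>"
  have "(\<integral>\<^sup>+ w. ?D w \<partial>unifs) \<le> ennreal (2 * a / (1 - \<kappa>) * \<kappa> ^ Suc m)" for m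
  proof -
    have "(\<integral>\<^sup>+ w. ?D w \<partial>unifs) \<le> (\<integral>\<^sup>+ w. ennreal \<bar>limit w - approx (Suc m) w\<bar> +
        ennreal \<bar>step (w 0) (limit (\<lambda>i. w (Suc i))) - step (w 0) (approx m (\<lambda>i. w (Suc i)))\<bar> \<partial>unifs)"
      by (intro nn_integral_mono ennreal_le_add) auto
    also have "\<dots> = (\<integral>\<^sup>+ w. ennreal \<bar>limit w - approx (Suc m) w\<bar> \<partial>unifs) +
        (\<integral>\<^sup>+ w. ennreal \<bar>step (w 0) (limit (\<lambda>i. w (Suc i))) - step (w 0) (approx m (\<lambda>i. w (Suc i)))\<bar> \<partial>unifs)"
      using measurable_step_tail[OF measurable_limit] measurable_step_tail[OF measurable_approx]
      by (intro nn_integral_add) auto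
    also have "\<dots> \<le> ennreal (\<kappa> ^ Suc m * a / (1 - \<kappa>)) + ennreal \<kappa> * ennreal (\<kappa> ^ m * a / (1 - \<kappa>))"
      by (intro add_mono nn_integral_limit_diff
        order_trans[OF nn_integral_step_unifs_diff mult_left_mono[OF nn_integral_limit_diff]]
        measurable_limit measurable_approx limit_nonneg approx_nonneg) simp
    also have "\<dots> = ennreal (2 * a / (1 - \<kappa>) * \<kappa> ^ Suc m)"
    proof -
      have nonneg: "\<kappa> ^ n * a / (1 - \<kappa>) \<ge> 0" for n
        using \<kappa> a_pos by (intro divide_nonneg_nonneg mult_nonneg_nonneg zero_le_power) auto
      have "k ^ Suc m * a / d + k * (k ^ m * a / d) = 2 * a / d * k ^ Suc m" for k d :: real
        by (cases "d = 0") (simp_all add: field_simps)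
      thus ?thesis
        using \<kappa> nonneg[of "Suc m"] nonneg[of m]
        by (simp only: ennreal_mult[OF less_imp_le[OF \<kappa>(1)] nonneg, symmetric]
          ennreal_plus[OF nonneg mult_nonneg_nonneg[OF less_imp_le[OF \<kappa>(1)] nonneg], symmetric])
    qed
    finally show ?thesis .
  qed
  moreover have "(\<lambda>m. ennreal (2 * a / (1 - \<kappa>) * \<kappa> ^ Suc m)) \<longlonglongrightarrow> ennreal (2 * a / (1 - \<kappa>) * 0)"
    using \<kappa> by (intro tendsto_ennrealI tendsto_mult tendsto_const LIMSEQ_Suc LIMSEQ_realpow_zero) auto
  ultimately have "(\<integral>\<^sup>+ w. ?D w \<partial>unifs) \<le> ennreal (2 * a / (1 - \<kappa>) * 0)"
    by (intro LIMSEQ_le_const) auto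
  hence "(\<integral>\<^sup>+ w. ?D w \<partial>unifs) = 0" by simp
  hence "AE w in unifs. ?D w = 0"
    using measurable_step_tail[OF measurable_limit]
    by (subst (asm) nn_integral_0_iff_AE) auto
  thus ?thesis by eventually_elim auto
qed

end

context bnb_contraction
begin

section \<open>Unrolling the intensity along the counts\<close>

text \<open>Here the observed counts are known, so only the intensity is iterated, and the dependence on
  its starting value dies out geometrically with ratio \<open>c2\<close>. The start \<open>1\<close> is an arbitrary positive
  number; starting at \<open>0\<close> would leave the range where the Lipschitz bound holds for positive
  counts.\<close>

primrec unroll :: "nat \<Rightarrow> (nat \<Rightarrow> nat) \<Rightarrow> real" where
  "unroll 0 y = 1"
| "unroll (Suc m) y = link (y 0) (unroll m (\<lambda>i. y (Suc i)))"

definition unrolled :: "(nat \<Rightarrow> nat) \<Rightarrow> real" where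
  "unrolled y = lim (\<lambda>m. unroll m y)"

lemma unroll_pos: "unroll m y > 0"
  by (cases m) (auto intro: link_pos)

lemma unroll_error:
  assumes "\<And>i. l i > 0" "\<And>i. l i = link (y i) (l (Suc i))"
  shows "\<bar>unroll m y - l 0\<bar> \<le> c2 ^ m * \<bar>1 - l m\<bar>"
  using assms
proof (induction m arbitrary: y l)
  case (Suc m)
  have "\<bar>unroll (Suc m) y - l 0\<bar> = \<bar>link (y 0) (unroll m (\<lambda>i. y (Suc i))) - link (y 0) (l (Suc 0))\<bar>"
    using Suc.prems(2)[of 0] by simp
  also have "\<dots> \<le> c2 * \<bar>unroll m (\<lambda>i. y (Suc i)) - l (Suc 0)\<bar>"
    using link_lipschitz[of "unroll m (\<lambda>i. y (Suc i))" "y 0" "l (Suc 0)" "y 0"] unroll_pos Suc.prems(1)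
    by simp
  also have "\<dots> \<le> c2 * (c2 ^ m * \<bar>1 - l (Suc m)\<bar>)"
    using c2 by (intro mult_left_mono Suc.IH[of "\<lambda>i. l (Suc i)"] Suc.prems) auto
  finally show ?case by simp
next
  case 0
  show ?case by simp
qed

lemma measurable_unroll [measurable]:
  "unroll m \<in> borel_measurable (Pi\<^sub>M UNIV (\<lambda>_. count_space UNIV))"
proof (induction m)
  case (Suc m)
  have "(\<lambda>y. link (y 0) (unroll m (\<lambda>i. y (Suc i)))) \<in> borel_measurable (Pi\<^sub>M UNIV (\<lambda>_. count_space UNIV))"
    by (intro measurable_link measurable_component_singleton measurable_compose[OF measurable_tail Suc]) simp
  thus ?case by simp
qed simp

lemma measurable_unrolled: "unrolled \<in> borel_measurable (Pi\<^sub>M UNIV (\<lambda>_. count_space UNIV))"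
  unfolding unrolled_def[abs_def] by measurable

end

section \<open>The stationary solution\<close>

locale bnb_driven = bnb_contraction r \<alpha> c1 c2 a G + prob_space M
  for r \<alpha> c1 c2 a :: real and G :: "nat \<Rightarrow> real \<Rightarrow> real" and M :: "'a measure" +
  fixes u :: "int \<Rightarrow> 'a \<Rightarrow> real"
  assumes iid: "iid_uniform M u"
begin

lemma measurable_u [measurable]: "u t \<in> borel_measurable M"
  using iid by (auto simp: iid_uniform_def indep_vars_def)

definition past :: "int \<Rightarrow> 'a \<Rightarrow> nat \<Rightarrow> real" where
  "past t \<omega> = (\<lambda>i. u (t - 1 - int i) \<omega>)"

lemma measurable_past: "past t \<in> measurable M (Pi\<^sub>M UNIV (\<lambda>_. borel))"
  unfolding past_def by (rule measurable_PiM_single') (auto simp: space_PiM)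

lemma distr_past: "distr M (Pi\<^sub>M UNIV (\<lambda>_. borel)) (past t) = unifs"
  using distr_iid_uniform[OF prob_space_axioms iid, of "\<lambda>i. t - 1 - int i"]
  by (simp add: past_def[abs_def] inj_on_def)

lemma nn_integral_past:
  assumes "\<phi> \<in> borel_measurable (Pi\<^sub>M UNIV (\<lambda>_. borel))"
  shows "(\<integral>\<^sup>+ \<omega>. \<phi> (past t \<omega>) \<partial>M) = (\<integral>\<^sup>+ w. \<phi> w \<partial>unifs)"
  unfolding distr_past[of t, symmetric] using assms by (subst nn_integral_distr) (auto intro: measurable_past)

lemma AE_past:
  assumes "AE w in unifs. P w"
  shows "AE \<omega> in M. P (past t \<omega>)"
  using AE_distrD[OF measurable_past, of P t, unfolded distr_past, OF assms] .

lemma past_Suc: "past (t + 1) \<omega> 0 = u t \<omega>" "(\<lambda>i. past (t + 1) \<omega> (Suc i)) = past t \<omega>"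
  by (simp_all add: past_def algebra_simps)

lemma nn_integral_now_past:
  assumes "(\<lambda>(v, w). \<phi> v w) \<in> borel_measurable (borel \<Otimes>\<^sub>M Pi\<^sub>M UNIV (\<lambda>_. borel))"
  shows "(\<integral>\<^sup>+ \<omega>. \<phi> (u t \<omega>) (past t \<omega>) \<partial>M) = (\<integral>\<^sup>+ w. \<integral>\<^sup>+ v. \<phi> v w \<partial>unif \<partial>unifs)"
proof -
  have "(\<lambda>w. (w 0, \<lambda>i. w (Suc i))) \<in> measurable (Pi\<^sub>M UNIV (\<lambda>_. borel)) (borel \<Otimes>\<^sub>M Pi\<^sub>M UNIV (\<lambda>_. borel))"
    by (intro measurable_Pair measurable_tail measurable_component_singleton) simp
  from measurable_compose[OF this assms]
  have "(\<lambda>w. \<phi> (w 0) (\<lambda>i. w (Suc i))) \<in> borel_measurable (Pi\<^sub>M UNIV (\<lambda>_. borel))" by simp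
  from nn_integral_past[OF this, of "t + 1"] show ?thesis
    by (simp only: past_Suc nn_integral_unifs_split[OF assms])
qed

text \<open>The candidates are defined pointwise as functions of the innovations. Thus the path is the
  image of the innovations under one map that commutes with the time shift, and the counts
  up to time \<open>t - 1\<close> depend on \<open>past t\<close> everywhere, not only almost surely.\<close>

definition intensity :: "int \<Rightarrow> 'a \<Rightarrow> real" where
  "intensity t \<omega> = limit (past t \<omega>)"

definition obs :: "int \<Rightarrow> 'a \<Rightarrow> nat" where
  "obs t \<omega> = bnb_count r \<alpha> (intensity t \<omega>) (u t \<omega>)"

lemma measurable_intensity [measurable]: "intensity t \<in> borel_measurable M"
  unfolding intensity_def by (intro measurable_compose[OF measurable_past measurable_limit])

lemma measurable_obs [measurable]: "obs t \<in> measurable M (count_space UNIV)"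
  unfolding obs_def[abs_def] by measurable

lemma AE_u: "AE \<omega> in M. \<forall>t. 0 < u t \<omega> \<and> u t \<omega> < 1"
proof (intro AE_all_countable[THEN iffD2] allI)
  fix t
  have distr: "distr M borel (u t) = unif" using iid by (simp add: iid_uniform_def)
  show "AE \<omega> in M. 0 < u t \<omega> \<and> u t \<omega> < 1"
    by (rule AE_distrD[OF measurable_u, of "\<lambda>v. 0 < v \<and> v < 1" t, unfolded distr, OF AE_unif])
qed

text \<open>Every value of \<open>step\<close> is positive, so the fixed point equation of the previous time
  already makes the intensity positive.\<close>

lemma AE_intensity:
  "AE \<omega> in M. \<forall>t. intensity t \<omega> > 0 \<and> intensity (t + 1) \<omega> = link (obs t \<omega>) (intensity t \<omega>)"
proof -
  have "AE \<omega> in M. \<forall>t. intensity (t + 1) \<omega> = step (u t \<omega>) (intensity t \<omega>)"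
  proof (intro AE_all_countable[THEN iffD2] allI)
    fix t
    show "AE \<omega> in M. intensity (t + 1) \<omega> = step (u t \<omega>) (intensity t \<omega>)"
      using AE_past[OF AE_limit_step, of "t + 1"] by (simp add: past_Suc intensity_def)
  qed
  thus ?thesis
  proof eventually_elim
    case (elim \<omega>)
    show ?case
    proof (intro allI conjI)
      fix t
      show "intensity t \<omega> > 0" using elim[rule_format, of "t - 1"] step_pos by simp
      show "intensity (t + 1) \<omega> = link (obs t \<omega>) (intensity t \<omega>)"
        using elim by (simp add: step_def obs_def)
    qed
  qed
qed

lemma solution: "bnb_ar_solution M r \<alpha> G u obs intensity"
  unfolding bnb_ar_solution_def
proof (intro conjI allI)
  show "AE \<omega> in M. \<forall>t. 0 < intensity t \<omega> \<and>
      real (obs t \<omega>) = bnb_quantile (intensity t \<omega>) r \<alpha> (u t \<omega>) \<and>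
      intensity (t + 1) \<omega> = G (obs t \<omega>) (intensity t \<omega>)"
    using AE_u AE_intensity
    by eventually_elim (auto simp: bnb_quantile_eq_count[OF r \<alpha>] obs_def link_def)
qed measurable

definition orbit :: "(int \<Rightarrow> real) \<Rightarrow> int \<Rightarrow> nat \<times> real" where
  "orbit x t = (bnb_count r \<alpha> (limit (\<lambda>i. x (t - 1 - int i))) (x t), limit (\<lambda>i. x (t - 1 - int i)))"

abbreviation state_space :: "(nat \<times> real) measure" where
  "state_space \<equiv> count_space UNIV \<Otimes>\<^sub>M borel"

lemma measurable_orbit:
  "orbit \<in> measurable (Pi\<^sub>M UNIV (\<lambda>_. borel)) (Pi\<^sub>M UNIV (\<lambda>_. state_space))"
proof (rule measurable_PiM_single')
  fix t :: int
  have "(\<lambda>x i. x (t - 1 - int i)) \<in> measurable (Pi\<^sub>M UNIV (\<lambda>_. borel)) (Pi\<^sub>M UNIV (\<lambda>_. borel))"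
    by (rule measurable_PiM_single') (auto simp: space_PiM)
  hence "(\<lambda>x. limit (\<lambda>i. x (t - 1 - int i))) \<in> borel_measurable (Pi\<^sub>M UNIV (\<lambda>_. borel))"
    by (rule measurable_compose[OF _ measurable_limit])
  thus "(\<lambda>x. orbit x t) \<in> measurable (Pi\<^sub>M UNIV (\<lambda>_. borel)) state_space"
    unfolding orbit_def by (intro measurable_Pair measurable_bnb_count measurable_component_singleton) auto
qed (auto simp: space_PiM space_pair_measure)

lemma measurable_u_path: "(\<lambda>\<omega> t. u (t + k) \<omega>) \<in> measurable M (Pi\<^sub>M UNIV (\<lambda>_::int. borel))"
  by (rule measurable_PiM_single') (auto simp: space_PiM)

lemma state_eq_orbit: "(obs t \<omega>, intensity t \<omega>) = orbit (\<lambda>t. u t \<omega>) t"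
  by (simp add: orbit_def obs_def intensity_def past_def)

lemma orbit_shift: "orbit x (t + k) = orbit (\<lambda>t. x (t + k)) t"
  by (simp add: orbit_def algebra_simps)

text \<open>The law of the path is the image of the law of the innovations, which is invariant under
  time shifts.\<close>

lemma stationary: "strictly_stationary M state_space (\<lambda>t \<omega>. (obs t \<omega>, intensity t \<omega>))"
  unfolding strictly_stationary_def state_eq_orbit
proof
  fix k
  have "distr M (Pi\<^sub>M UNIV (\<lambda>_. state_space)) (\<lambda>\<omega> t. orbit (\<lambda>t. u t \<omega>) (t + k))
      = distr (Pi\<^sub>M UNIV (\<lambda>_. unif)) (Pi\<^sub>M UNIV (\<lambda>_. state_space)) orbit" for k
  proof -
    have "distr (Pi\<^sub>M UNIV (\<lambda>_. unif)) (Pi\<^sub>M UNIV (\<lambda>_. state_space)) orbit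
        = distr M (Pi\<^sub>M UNIV (\<lambda>_. state_space)) (orbit \<circ> (\<lambda>\<omega> t. u (t + k) \<omega>))"
      using distr_iid_uniform[OF prob_space_axioms iid, of "\<lambda>t. t + k"]
        distr_distr[OF measurable_orbit measurable_u_path[of k]]
      by (simp add: inj_on_def)
    also have "orbit \<circ> (\<lambda>\<omega> t. u (t + k) \<omega>) = (\<lambda>\<omega> t. orbit (\<lambda>t. u t \<omega>) (t + k))"
      by (simp add: fun_eq_iff orbit_shift)
    finally show ?thesis by simp
  qed
  from this[of k] this[of 0]
  show "distr M (Pi\<^sub>M UNIV (\<lambda>_. state_space)) (\<lambda>\<omega> t. orbit (\<lambda>t. u t \<omega>) (t + k))
      = distr M (Pi\<^sub>M UNIV (\<lambda>_. state_space)) (\<lambda>\<omega> t. orbit (\<lambda>t. u t \<omega>) t)"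
    by simp
qed

text \<open>An invariant set of paths pulls back to an invariant set of innovations, to which the
  ergodicity of the Bernoulli shift applies.\<close>

lemma ergodic: "ergodic_process M state_space (\<lambda>t \<omega>. (obs t \<omega>, intensity t \<omega>))"
  unfolding ergodic_process_def state_eq_orbit
proof (intro ballI impI)
  let ?P = "Pi\<^sub>M UNIV (\<lambda>_::int. unif)" and ?S = "Pi\<^sub>M UNIV (\<lambda>_::int. state_space)"
  fix A assume A: "A \<in> sets ?S" and inv: "(\<lambda>x t. x (t + 1)) -` A \<inter> space ?S = A"
  have distr: "distr M (Pi\<^sub>M UNIV (\<lambda>_. borel)) (\<lambda>\<omega> t. u t \<omega>) = ?P"
    using distr_iid_uniform[OF prob_space_axioms iid, of "\<lambda>t. t"] by simp
  have sets: "sets (Pi\<^sub>M UNIV (\<lambda>_::int. borel)) = sets ?P"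
    by (intro sets_PiM_cong) auto
  define B where "B = orbit -` A"
  have B': "B \<in> sets (Pi\<^sub>M UNIV (\<lambda>_. borel))"
    using measurable_sets[OF measurable_orbit A] by (simp add: B_def space_PiM)
  have "x \<in> B \<longleftrightarrow> (\<lambda>t. x (t + 1)) \<in> B" for x
  proof -
    have "orbit x \<in> A \<longleftrightarrow> (\<lambda>t. orbit x (t + 1)) \<in> A"
      by (subst inv[symmetric]) (auto simp: space_PiM space_pair_measure)
    thus ?thesis by (simp add: B_def orbit_shift)
  qed
  hence "(\<lambda>x t. x (t + 1)) -` B \<inter> space ?P = B"
    by (auto simp: space_PiM)
  with B' sets have "measure ?P B \<in> {0, 1}"
    by (intro shift_ergodic prob_space_unif) auto
  also have "measure ?P B = measure M ((\<lambda>\<omega> t. u t \<omega>) -` B \<inter> space M)"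
    unfolding distr[symmetric] using measurable_u_path[of 0] B' by (subst measure_distr) auto
  also have "(\<lambda>\<omega> t. u t \<omega>) -` B \<inter> space M = {\<omega> \<in> space M. (\<lambda>t. orbit (\<lambda>t. u t \<omega>) t) \<in> A}"
    by (auto simp: B_def)
  finally show "measure M {\<omega> \<in> space M. (\<lambda>t. orbit (\<lambda>t. u t \<omega>) t) \<in> A} \<in> {0, 1}" .
qed

lemma causal_intensity: "causal M u intensity"
  unfolding causal_def using measurable_limit by (auto simp: intensity_def past_def)

lemma nn_integral_obs:
  assumes h: "h \<in> borel_measurable (Pi\<^sub>M UNIV (\<lambda>_. borel))" and nonneg: "\<And>w. h w \<ge> 0"
  shows "(\<integral>\<^sup>+ \<omega>. ennreal (real (bnb_count r \<alpha> (h (past t \<omega>)) (u t \<omega>))) \<partial>M)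
    = (\<integral>\<^sup>+ \<omega>. ennreal (h (past t \<omega>)) \<partial>M)"
proof -
  note [measurable] = h
  have "(\<integral>\<^sup>+ \<omega>. ennreal (real (bnb_count r \<alpha> (h (past t \<omega>)) (u t \<omega>))) \<partial>M)
      = (\<integral>\<^sup>+ w. \<integral>\<^sup>+ v. ennreal (real (bnb_count r \<alpha> (h w) v)) \<partial>unif \<partial>unifs)"
    by (rule nn_integral_now_past[where \<phi> = "\<lambda>v w. ennreal (real (bnb_count r \<alpha> (h w) v))"])
       (simp add: split_beta')
  also have "\<dots> = (\<integral>\<^sup>+ \<omega>. ennreal (h (past t \<omega>)) \<partial>M)"
    using h by (subst nn_integral_past) (auto simp: nn_integral_bnb_count[OF r \<alpha> nonneg])
  finally show ?thesis .
qed

lemma integrable_obs: "integrable M (\<lambda>\<omega>. real (obs t \<omega>))"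
proof (rule integrableI_nonneg)
  have "(\<integral>\<^sup>+ \<omega>. ennreal (real (obs t \<omega>)) \<partial>M) = (\<integral>\<^sup>+ w. ennreal (limit w) \<partial>unifs)"
    unfolding obs_def intensity_def nn_integral_obs[OF measurable_limit limit_nonneg]
    by (rule nn_integral_past) measurable
  thus "(\<integral>\<^sup>+ \<omega>. ennreal (real (obs t \<omega>)) \<partial>M) < \<infinity>"
    using nn_integral_limit_finite by simp
qed simp_all

theorem stationary_ergodic_causal_solution_obs:
  "stationary_ergodic_causal_solution M r \<alpha> G u obs intensity"
  unfolding stationary_ergodic_causal_solution_def
  by (intro conjI allI solution stationary ergodic causal_intensity integrable_obs)


section \<open>Uniqueness\<close>

lemma nn_integral_past_contraction:
  assumes h: "h \<in> borel_measurable (Pi\<^sub>M UNIV (\<lambda>_. borel))" "h' \<in> borel_measurable (Pi\<^sub>M UNIV (\<lambda>_. borel))"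
    and nonneg: "\<And>w. h w \<ge> 0" "\<And>w. h' w \<ge> 0"
  shows "(\<integral>\<^sup>+ \<omega>. ennreal \<bar>step (u t \<omega>) (h (past t \<omega>)) - step (u t \<omega>) (h' (past t \<omega>))\<bar> \<partial>M)
    \<le> ennreal \<kappa> * (\<integral>\<^sup>+ \<omega>. ennreal \<bar>h (past t \<omega>) - h' (past t \<omega>)\<bar> \<partial>M)"
proof -
  let ?\<phi> = "\<lambda>w. ennreal \<bar>step (w 0) (h (\<lambda>i. w (Suc i))) - step (w 0) (h' (\<lambda>i. w (Suc i)))\<bar>"
  have "?\<phi> \<in> borel_measurable (Pi\<^sub>M UNIV (\<lambda>_. borel))"
    using measurable_step_tail[OF h(1)] measurable_step_tail[OF h(2)] by simp
  from nn_integral_past[OF this, of "t + 1"]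
  have "(\<integral>\<^sup>+ \<omega>. ennreal \<bar>step (u t \<omega>) (h (past t \<omega>)) - step (u t \<omega>) (h' (past t \<omega>))\<bar> \<partial>M)
      = (\<integral>\<^sup>+ w. ?\<phi> w \<partial>unifs)"
    by (simp only: past_Suc)
  also have "\<dots> \<le> ennreal \<kappa> * (\<integral>\<^sup>+ w. ennreal \<bar>h w - h' w\<bar> \<partial>unifs)"
    by (rule nn_integral_step_unifs_diff[OF h nonneg])
  also have "(\<integral>\<^sup>+ w. ennreal \<bar>h w - h' w\<bar> \<partial>unifs) = (\<integral>\<^sup>+ \<omega>. ennreal \<bar>h (past t \<omega>) - h' (past t \<omega>)\<bar> \<partial>M)"
    using h by (intro nn_integral_past[symmetric]) simp
  finally show ?thesis .
qed

lemma nn_integral_intensity: "(\<integral>\<^sup>+ \<omega>. ennreal (intensity t \<omega>) \<partial>M) = (\<integral>\<^sup>+ w. ennreal (limit w) \<partial>unifs)"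
  unfolding intensity_def by (rule nn_integral_past) measurable

text \<open>For two causal solutions the newest innovation is independent of both intensities, so the mean
  distance of the intensities shrinks at least by the factor \<open>\<kappa>\<close> at every time. Going back
  \<open>m\<close> steps bounds it by \<open>\<kappa> ^ m\<close> times a quantity that does not depend on
  \<open>m\<close>: by stationarity the mean intensity is constant in time, and it equals the finite
  mean of the counts.\<close>

theorem solution_unique:
  assumes sol: "stationary_ergodic_causal_solution M r \<alpha> G u y l"
  shows "AE \<omega> in M. \<forall>t. y t \<omega> = obs t \<omega> \<and> l t \<omega> = intensity t \<omega>"
proof -
  have eqs: "AE \<omega> in M. \<forall>t. 0 < l t \<omega> \<and> real (y t \<omega>) = bnb_quantile (l t \<omega>) r \<alpha> (u t \<omega>) \<and>
        l (t + 1) \<omega> = G (y t \<omega>) (l t \<omega>)"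
    and [measurable]: "\<And>t. y t \<in> measurable M (count_space UNIV)" "\<And>t. l t \<in> borel_measurable M"
    and stat: "strictly_stationary M state_space (\<lambda>t \<omega>. (y t \<omega>, l t \<omega>))"
    and caus: "causal M u l" and int: "\<And>t. integrable M (\<lambda>\<omega>. real (y t \<omega>))"
    using sol by (auto simp: stationary_ergodic_causal_solution_def bnb_ar_solution_def)
  have y_eq: "AE \<omega> in M. \<forall>t. 0 < l t \<omega> \<and> y t \<omega> = bnb_count r \<alpha> (l t \<omega>) (u t \<omega>) \<and>
      l (t + 1) \<omega> = step (u t \<omega>) (l t \<omega>)"
    using eqs AE_u
  proof eventually_elim
    case (elim \<omega>)
    show ?case
    proof
      fix t
      have l: "0 < l t \<omega>" "l (t + 1) \<omega> = G (y t \<omega>) (l t \<omega>)" and u: "0 < u t \<omega>" "u t \<omega> < 1"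
        and "real (y t \<omega>) = bnb_quantile (l t \<omega>) r \<alpha> (u t \<omega>)"
        using elim by blast+
      hence "y t \<omega> = bnb_count r \<alpha> (l t \<omega>) (u t \<omega>)"
        by (simp add: bnb_quantile_eq_count[OF r \<alpha> l(1) u])
      with l show "0 < l t \<omega> \<and> y t \<omega> = bnb_count r \<alpha> (l t \<omega>) (u t \<omega>) \<and>
          l (t + 1) \<omega> = step (u t \<omega>) (l t \<omega>)"
        by (simp add: step_def link_def)
    qed
  qed
  obtain h where h[measurable]: "\<And>t. h t \<in> borel_measurable (Pi\<^sub>M UNIV (\<lambda>_. borel))"
    and h_eq: "\<And>t. AE \<omega> in M. l t \<omega> = h t (past t \<omega>)"
    using caus unfolding causal_def past_def by metis
  \<comment> \<open>The function given by causality has to be nonnegative everywhere, not only on the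
    almost sure event, for the contraction to apply to it.\<close>
  define k where "k t w = max 0 (h t w)" for t w
  have k[measurable]: "k t \<in> borel_measurable (Pi\<^sub>M UNIV (\<lambda>_. borel))" for t
    unfolding k_def[abs_def] by measurable
  have k0: "k t w \<ge> 0" for t w by (simp add: k_def)
  have k_eq: "AE \<omega> in M. l t \<omega> = k t (past t \<omega>)" for t
    using h_eq[of t] y_eq
  proof eventually_elim
    case (elim \<omega>)
    hence "l t \<omega> > 0" by blast
    with elim(1) show ?case by (simp add: k_def)
  qed
  define D where "D t = (\<integral>\<^sup>+ \<omega>. ennreal \<bar>l t \<omega> - intensity t \<omega>\<bar> \<partial>M)" for t
  have D_Suc: "D (t + 1) \<le> ennreal \<kappa> * D t" for t
  proof -
    have "D (t + 1) = (\<integral>\<^sup>+ \<omega>. ennreal \<bar>step (u t \<omega>) (k t (past t \<omega>)) - step (u t \<omega>) (limit (past t \<omega>))\<bar> \<partial>M)"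
      unfolding D_def
    proof (intro nn_integral_cong_AE)
      show "AE \<omega> in M. ennreal \<bar>l (t + 1) \<omega> - intensity (t + 1) \<omega>\<bar>
          = ennreal \<bar>step (u t \<omega>) (k t (past t \<omega>)) - step (u t \<omega>) (limit (past t \<omega>))\<bar>"
        using y_eq k_eq[of t] AE_intensity
      proof eventually_elim
        case (elim \<omega>)
        hence "l (t + 1) \<omega> = step (u t \<omega>) (k t (past t \<omega>))" by metis
        moreover have "intensity (t + 1) \<omega> = step (u t \<omega>) (limit (past t \<omega>))"
          using elim(3) by (simp add: step_def obs_def intensity_def)
        ultimately show ?case by simp
      qed
    qed
    also have "\<dots> \<le> ennreal \<kappa> * (\<integral>\<^sup>+ \<omega>. ennreal \<bar>k t (past t \<omega>) - limit (past t \<omega>)\<bar> \<partial>M)"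
      by (rule nn_integral_past_contraction[OF k measurable_limit k0 limit_nonneg])
    also have "(\<integral>\<^sup>+ \<omega>. ennreal \<bar>k t (past t \<omega>) - limit (past t \<omega>)\<bar> \<partial>M) = D t"
      unfolding D_def intensity_def
    proof (intro nn_integral_cong_AE)
      show "AE \<omega> in M. ennreal \<bar>k t (past t \<omega>) - limit (past t \<omega>)\<bar> = ennreal \<bar>l t \<omega> - limit (past t \<omega>)\<bar>"
        using k_eq[of t] by eventually_elim simp
    qed
    finally show ?thesis .
  qed
  have D_iter: "D t \<le> ennreal (\<kappa> ^ m) * D (t - int m)" for t m
  proof (induction m arbitrary: t)
    case (Suc m)
    have "D t \<le> ennreal \<kappa> * D (t - 1)" using D_Suc[of "t - 1"] by simp
    also have "\<dots> \<le> ennreal \<kappa> * (ennreal (\<kappa> ^ m) * D (t - 1 - int m))"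
      by (intro mult_left_mono Suc) simp
    also have "\<dots> = ennreal (\<kappa> ^ Suc m) * D (t - int (Suc m))"
    proof -
      have "t - 1 - int m = t - int (Suc m)" by simp
      thus ?thesis
        using \<kappa>(1) by (simp only: power_Suc ennreal_mult'[OF less_imp_le] mult.assoc)
    qed
    finally show ?case .
  qed simp
  have mean_l: "(\<integral>\<^sup>+ \<omega>. ennreal (l t \<omega>) \<partial>M) = (\<integral>\<^sup>+ \<omega>. ennreal (l 0 \<omega>) \<partial>M)" for t
  proof -
    let ?S = "Pi\<^sub>M UNIV (\<lambda>_::int. state_space)"
    have path: "(\<lambda>\<omega> s. (y (s + j) \<omega>, l (s + j) \<omega>)) \<in> measurable M ?S" for j
      by (rule measurable_PiM_single') (auto simp: space_PiM space_pair_measure)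
    have "(\<lambda>x. x 0) \<in> measurable ?S state_space"
      by (rule measurable_component_singleton) simp
    from measurable_compose[OF this, of "\<lambda>z. ennreal (snd z)" borel]
    have f: "(\<lambda>x. ennreal (snd (x 0))) \<in> borel_measurable ?S" by simp
    have "(\<integral>\<^sup>+ \<omega>. ennreal (l j \<omega>) \<partial>M)
        = (\<integral>\<^sup>+ x. ennreal (snd (x 0)) \<partial>distr M ?S (\<lambda>\<omega> s. (y (s + j) \<omega>, l (s + j) \<omega>)))" for j
      by (subst nn_integral_distr[OF path]) (use f in auto)
    from this[of t] this[of 0] stat show ?thesis
      by (simp add: strictly_stationary_def)
  qed
  have fin_l: "(\<integral>\<^sup>+ \<omega>. ennreal (l 0 \<omega>) \<partial>M) < \<infinity>"
  proof -
    have "(\<integral>\<^sup>+ \<omega>. ennreal (l 0 \<omega>) \<partial>M) = (\<integral>\<^sup>+ \<omega>. ennreal (k 0 (past 0 \<omega>)) \<partial>M)"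
      by (intro nn_integral_cong_AE eventually_mono[OF k_eq[of 0]]) simp
    also have "\<dots> = (\<integral>\<^sup>+ \<omega>. ennreal (real (bnb_count r \<alpha> (k 0 (past 0 \<omega>)) (u 0 \<omega>))) \<partial>M)"
      by (rule nn_integral_obs[OF k k0, symmetric])
    also have "\<dots> = (\<integral>\<^sup>+ \<omega>. ennreal (real (y 0 \<omega>)) \<partial>M)"
    proof (intro nn_integral_cong_AE)
      show "AE \<omega> in M. ennreal (real (bnb_count r \<alpha> (k 0 (past 0 \<omega>)) (u 0 \<omega>))) = ennreal (real (y 0 \<omega>))"
        using k_eq[of 0] y_eq by eventually_elim metis
    qed
    also have "\<dots> < \<infinity>" using int[of 0] by (auto simp: integrable_iff_bounded)
    finally show ?thesis .
  qed
  define b where "b = enn2real ((\<integral>\<^sup>+ \<omega>. ennreal (l 0 \<omega>) \<partial>M) + (\<integral>\<^sup>+ w. ennreal (limit w) \<partial>unifs))"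
  have b: "ennreal b = (\<integral>\<^sup>+ \<omega>. ennreal (l 0 \<omega>) \<partial>M) + (\<integral>\<^sup>+ w. ennreal (limit w) \<partial>unifs)" "b \<ge> 0"
    using fin_l nn_integral_limit_finite unfolding b_def by (auto simp: ennreal_enn2real_if)
  have D_bound: "D t \<le> ennreal b" for t
  proof -
    have "D t \<le> (\<integral>\<^sup>+ \<omega>. ennreal (l t \<omega>) + ennreal (intensity t \<omega>) \<partial>M)"
      unfolding D_def
    proof (intro nn_integral_mono_AE)
      show "AE \<omega> in M. ennreal \<bar>l t \<omega> - intensity t \<omega>\<bar> \<le> ennreal (l t \<omega>) + ennreal (intensity t \<omega>)"
        using y_eq
      proof eventually_elim
        case (elim \<omega>)
        hence "l t \<omega> > 0" by blast
        thus ?case using limit_nonneg[of "past t \<omega>"] by (intro ennreal_le_add) (auto simp: intensity_def)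
      qed
    qed
    also have "\<dots> = (\<integral>\<^sup>+ \<omega>. ennreal (l t \<omega>) \<partial>M) + (\<integral>\<^sup>+ \<omega>. ennreal (intensity t \<omega>) \<partial>M)"
      by (intro nn_integral_add) auto
    also have "\<dots> = ennreal b"
      unfolding b(1) mean_l[of t] nn_integral_intensity ..
    finally show ?thesis .
  qed
  have "D t = 0" for t
  proof -
    have "D t \<le> ennreal (\<kappa> ^ m * b)" for m
    proof -
      have "D t \<le> ennreal (\<kappa> ^ m) * ennreal b"
        by (rule order_trans[OF D_iter mult_left_mono[OF D_bound]]) simp
      thus ?thesis using \<kappa> b by (simp add: ennreal_mult')
    qed
    moreover have "(\<lambda>m. ennreal (\<kappa> ^ m * b)) \<longlonglongrightarrow> ennreal (0 * b)"
      using \<kappa> by (intro tendsto_ennrealI tendsto_mult tendsto_const LIMSEQ_realpow_zero) auto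
    ultimately have "D t \<le> ennreal (0 * b)"
      by (intro LIMSEQ_le_const) auto
    thus ?thesis by simp
  qed
  hence "AE \<omega> in M. l t \<omega> = intensity t \<omega>" for t
    unfolding D_def by (subst (asm) nn_integral_0_iff_AE) auto
  hence "AE \<omega> in M. \<forall>t. l t \<omega> = intensity t \<omega>"
    by (simp add: AE_all_countable)
  with y_eq show ?thesis
    by eventually_elim (simp add: obs_def)
qed

section \<open>The intensity as a function of the past counts\<close>

text \<open>After unrolling \<open>m\<close> steps the error is at most \<open>c2 ^ m\<close> times the distance of a past intensity
  from \<open>1\<close>. These distances have the same finite mean at all times, so the errors
  are summable almost surely and tend to \<open>0\<close>.\<close>

theorem AE_intensity_eq_unrolled:
  "AE \<omega> in M. intensity t \<omega> = unrolled (\<lambda>i. obs (t - 1 - int i) \<omega>)"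
proof -
  let ?e = "\<lambda>m \<omega>. c2 ^ m * \<bar>1 - intensity (t - int m) \<omega>\<bar>"
  let ?B = "\<integral>\<^sup>+ w. ennreal \<bar>1 - limit w\<bar> \<partial>unifs"
  have e: "(\<integral>\<^sup>+ \<omega>. ennreal (?e m \<omega>) \<partial>M) = ennreal (c2 ^ m) * ?B" for m
  proof -
    have "(\<integral>\<^sup>+ \<omega>. ennreal (?e m \<omega>) \<partial>M) = ennreal (c2 ^ m) * (\<integral>\<^sup>+ \<omega>. ennreal \<bar>1 - intensity (t - int m) \<omega>\<bar> \<partial>M)"
      using c2 by (subst nn_integral_cmult[symmetric]) (auto simp: ennreal_mult')
    also have "(\<integral>\<^sup>+ \<omega>. ennreal \<bar>1 - intensity (t - int m) \<omega>\<bar> \<partial>M) = ?B"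
      unfolding intensity_def by (rule nn_integral_past) measurable
    finally show ?thesis .
  qed
  have "?B \<le> (\<integral>\<^sup>+ w. 1 + ennreal (limit w) \<partial>unifs)"
    unfolding ennreal_1[symmetric]
  proof (intro nn_integral_mono ennreal_le_add)
    fix w show "\<bar>1 - limit w\<bar> \<le> 1 + limit w" using limit_nonneg[of w] by simp
  qed (auto simp: limit_nonneg)
  also have "\<dots> = 1 + (\<integral>\<^sup>+ w. ennreal (limit w) \<partial>unifs)"
    using prob_space.emeasure_space_1[OF prob_space_unifs] by (subst nn_integral_add) auto
  also have "\<dots> < \<infinity>" using nn_integral_limit_finite by simp
  finally have B: "?B < \<infinity>" .
  have geom: "(\<Sum>m. ennreal (c2 ^ m)) = ennreal (1 / (1 - c2))"
    using c1 c2 c12 by (intro suminf_ennreal_eq geometric_sums) auto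
  have "(\<integral>\<^sup>+ \<omega>. (\<Sum>m. ennreal (?e m \<omega>)) \<partial>M) = (\<Sum>m. ennreal (c2 ^ m) * ?B)"
    by (subst nn_integral_suminf) (auto simp: e)
  also have "\<dots> = ennreal (1 / (1 - c2)) * ?B"
    by (simp add: geom)
  also have "\<dots> < \<infinity>"
    using B by (simp add: ennreal_mult_less_top)
  finally have "(\<integral>\<^sup>+ \<omega>. (\<Sum>m. ennreal (?e m \<omega>)) \<partial>M) \<noteq> \<infinity>" by simp
  hence "AE \<omega> in M. (\<Sum>m. ennreal (?e m \<omega>)) \<noteq> \<infinity>"
    by (intro nn_integral_PInf_AE) auto
  thus ?thesis using AE_intensity
  proof eventually_elim
    case (elim \<omega>)
    have "summable (\<lambda>m. ?e m \<omega>)"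
      using elim(1) c2 by (intro summable_suminf_not_top) auto
    hence null: "(\<lambda>m. ?e m \<omega>) \<longlonglongrightarrow> 0" by (rule summable_LIMSEQ_zero)
    let ?y = "\<lambda>i. obs (t - 1 - int i) \<omega>" and ?l = "\<lambda>i. intensity (t - int i) \<omega>"
    have "\<bar>unroll m ?y - ?l 0\<bar> \<le> c2 ^ m * \<bar>1 - ?l m\<bar>" for m
    proof (rule unroll_error)
      fix i
      show "?l i > 0" using elim(2) by blast
      show "?l i = link (?y i) (?l (Suc i))"
        using elim(2)[rule_format, of "t - 1 - int i"] by (simp add: algebra_simps)
    qed
    hence "(\<lambda>m. unroll m ?y - ?l 0) \<longlonglongrightarrow> 0"
      by (intro Lim_null_comparison[OF always_eventually null]) simp
    hence "(\<lambda>m. unroll m ?y) \<longlonglongrightarrow> intensity t \<omega>"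
      by (simp add: LIM_zero_iff)
    thus ?case by (simp add: unrolled_def limI)
  qed
qed

section \<open>The conditional distribution\<close>

lemma sets_past_sigma:
  "sets (past_sigma M y t) = sigma_sets (space M) {y s -` A \<inter> space M |s A. s \<le> t}"
  unfolding past_sigma_def by (rule sets_measure_of) auto

lemma subalgebra_past_sigma: "subalgebra M (past_sigma M obs t)"
proof -
  have "{obs s -` A \<inter> space M |s A. s \<le> t} \<subseteq> sets M"
    by (auto intro: measurable_sets[OF measurable_obs])
  from sets.sigma_sets_subset[OF this] show ?thesis
    unfolding subalgebra_def sets_past_sigma by (simp add: past_sigma_def space_measure_of_conv)
qed

text \<open>The \<open>\<sigma>\<close>-field of the past counts is contained in that of the past innovations, which are
  independent of the current one.\<close>

lemma past_sigma_preimage: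
  assumes "A \<in> sets (past_sigma M obs (t - 1))"
  obtains B where "B \<in> sets (Pi\<^sub>M UNIV (\<lambda>_. borel))" "A = past t -` B \<inter> space M"
proof -
  let ?V = "vimage_algebra (space M) (past t) (Pi\<^sub>M UNIV (\<lambda>_. borel))"
  have V: "sets ?V = {past t -` B \<inter> space M |B. B \<in> sets (Pi\<^sub>M UNIV (\<lambda>_. borel))}"
    by (rule sets_vimage_algebra2) (auto simp: space_PiM)
  have "obs s -` A \<inter> space M \<in> sets ?V" if "s \<le> t - 1" for s A
  proof -
    let ?\<psi> = "\<lambda>w. bnb_count r \<alpha> (limit (\<lambda>i. w (i + nat (t - s)))) (w (nat (t - 1 - s)))"
    have "(\<lambda>w i. w (i + nat (t - s))) \<in> measurable (Pi\<^sub>M UNIV (\<lambda>_. borel)) (Pi\<^sub>M UNIV (\<lambda>_. borel))"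
      by (rule measurable_PiM_single') (auto simp: space_PiM)
    from measurable_compose[OF this measurable_limit]
    have \<psi>: "?\<psi> \<in> measurable (Pi\<^sub>M UNIV (\<lambda>_. borel)) (count_space UNIV)"
      by (intro measurable_bnb_count measurable_component_singleton) auto
    have "obs s \<omega> = ?\<psi> (past t \<omega>)" for \<omega>
      using that by (simp add: obs_def intensity_def past_def algebra_simps)
    hence "obs s -` A \<inter> space M = past t -` (?\<psi> -` A \<inter> space (Pi\<^sub>M UNIV (\<lambda>_. borel))) \<inter> space M"
      by (auto simp: space_PiM)
    moreover have "?\<psi> -` A \<inter> space (Pi\<^sub>M UNIV (\<lambda>_. borel)) \<in> sets (Pi\<^sub>M UNIV (\<lambda>_. borel))"
      by (rule measurable_sets[OF \<psi>]) simp
    ultimately show ?thesis unfolding V by blast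
  qed
  hence "{obs s -` A \<inter> space M |s A. s \<le> t - 1} \<subseteq> sets ?V" by blast
  from sets.sigma_sets_subset[OF this] have "sets (past_sigma M obs (t - 1)) \<subseteq> sets ?V"
    unfolding sets_past_sigma space_vimage_algebra .
  thus ?thesis using assms that unfolding V by blast
qed

text \<open>Conditioning on the past innovations fixes the intensity and leaves the current innovation
  uniform, so the count has the mass function belonging to that intensity. Since the intensity
  is a function of the past counts, the same mass function is the conditional probability given
  the smaller \<open>\<sigma>\<close>-field of the past counts.\<close>

theorem conditionally_bnb_obs: "conditionally_bnb M r \<alpha> obs intensity"
  unfolding conditionally_bnb_def
proof (intro allI)
  fix t k
  let ?F = "past_sigma M obs (t - 1)"
  interpret finite_measure_subalgebra M ?F
    by unfold_locales (rule subalgebra_past_sigma)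
  define g where "g \<omega> = bnb_mass (unrolled (\<lambda>i. obs (t - 1 - int i) \<omega>)) r \<alpha> k" for \<omega>
  have space: "space ?F = space M" and sets: "sets ?F \<subseteq> sets M"
    using subalgebra_past_sigma by (auto simp: subalgebra_def)
  have obs_F: "obs s \<in> measurable ?F (count_space UNIV)" if "s \<le> t - 1" for s
  proof (rule measurableI)
    fix A
    have "obs s -` A \<inter> space M \<in> sigma_sets (space M) {obs s -` A \<inter> space M |s A. s \<le> t - 1}"
      using that by (intro sigma_sets.Basic) blast
    thus "obs s -` A \<inter> space ?F \<in> sets ?F"
      unfolding space sets_past_sigma .
  qed simp
  have "(\<lambda>\<omega> i. obs (t - 1 - int i) \<omega>) \<in> measurable ?F (Pi\<^sub>M UNIV (\<lambda>_. count_space UNIV))"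
    by (rule measurable_PiM_single') (auto intro!: obs_F simp: space_PiM)
  from measurable_compose[OF this measurable_unrolled]
  have gF: "g \<in> borel_measurable ?F"
    unfolding g_def[abs_def] by (rule measurable_compose[OF _ borel_measurable_bnb_mass])
  have g_eq: "AE \<omega> in M. g \<omega> = bnb_mass (intensity t \<omega>) r \<alpha> k \<and> 0 < g \<omega> \<and> g \<omega> \<le> 1"
    using AE_intensity_eq_unrolled[of t] AE_intensity
  proof eventually_elim
    case (elim \<omega>)
    have pos: "intensity t \<omega> > 0" using elim(2) by blast
    have "bnb_mass (intensity t \<omega>) r \<alpha> k \<le> (\<Sum>i\<le>k. bnb_mass (intensity t \<omega>) r \<alpha> i)"
      using bnb_mass_pos[OF r \<alpha> pos] by (intro member_le_sum) (auto intro: less_imp_le)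
    also have "\<dots> < 1" by (rule bnb_cumulative_less_1[OF r \<alpha> pos])
    finally show ?case using elim(1) bnb_mass_pos[OF r \<alpha> pos, of k] by (simp add: g_def)
  qed
  have gM [measurable]: "g \<in> borel_measurable M"
    by (rule measurable_from_subalg[OF subalgebra_past_sigma gF])
  have ind_eq: "(indicator {\<omega>. obs t \<omega> = k} :: 'a \<Rightarrow> real) = (\<lambda>\<omega>. indicator {k} (obs t \<omega>))"
    by (auto simp: indicator_def)
  have indM [measurable]: "(indicator {\<omega>. obs t \<omega> = k} :: 'a \<Rightarrow> real) \<in> borel_measurable M"
    unfolding ind_eq by (rule measurable_compose[OF measurable_obs]) simp
  have "AE \<omega> in M. real_cond_exp M ?F (indicator {\<omega>. obs t \<omega> = k}) \<omega> = g \<omega>"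
  proof (rule real_cond_exp_charact)
    show "integrable M g"
      by (rule integrable_const_bound[of _ 1]) (use g_eq in \<open>auto elim: eventually_mono\<close>)
    show "integrable M (indicator {\<omega>. obs t \<omega> = k} :: 'a \<Rightarrow> real)"
      by (rule integrable_const_bound[of _ 1]) (auto simp: indicator_def)
    show "g \<in> borel_measurable ?F" by (rule gF)
    fix A assume A: "A \<in> sets ?F"
    hence AM [measurable]: "A \<in> sets M" using sets by blast
    obtain B where B [measurable]: "B \<in> sets (Pi\<^sub>M UNIV (\<lambda>_. borel))" and AB: "A = past t -` B \<inter> space M"
      by (rule past_sigma_preimage[OF A])
    let ?m = "\<lambda>w. indicator B w * ennreal (bnb_mass (limit w) r \<alpha> k)"
    have "(\<integral>\<^sup>+ \<omega>. ennreal (indicator A \<omega> * indicator {\<omega>. obs t \<omega> = k} \<omega>) \<partial>M)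
        = (\<integral>\<^sup>+ \<omega>. indicator B (past t \<omega>) * indicator {k} (bnb_count r \<alpha> (limit (past t \<omega>)) (u t \<omega>)) \<partial>M)"
      by (intro nn_integral_cong) (auto simp: AB obs_def intensity_def indicator_def)
    also have "\<dots> = (\<integral>\<^sup>+ w. \<integral>\<^sup>+ v. indicator B w * indicator {k} (bnb_count r \<alpha> (limit w) v) \<partial>unif \<partial>unifs)"
    proof (rule nn_integral_now_past[where \<phi> = "\<lambda>v w. indicator B w * indicator {k} (bnb_count r \<alpha> (limit w) v)"])
      have "(\<lambda>z. bnb_count r \<alpha> (limit (snd z)) (fst z)) \<in> measurable (borel \<Otimes>\<^sub>M Pi\<^sub>M UNIV (\<lambda>_. borel)) (count_space UNIV)"
        by measurable
      from measurable_compose[OF this, of "indicator {k} :: nat \<Rightarrow> ennreal" borel]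
      have "(\<lambda>z. indicator {k} (bnb_count r \<alpha> (limit (snd z)) (fst z)) :: ennreal)
          \<in> borel_measurable (borel \<Otimes>\<^sub>M Pi\<^sub>M UNIV (\<lambda>_. borel))" by simp
      moreover have "(\<lambda>z. indicator B (snd z) :: ennreal) \<in> borel_measurable (borel \<Otimes>\<^sub>M Pi\<^sub>M UNIV (\<lambda>_. borel))"
        by measurable
      ultimately show "(\<lambda>(v, w). indicator B w * indicator {k} (bnb_count r \<alpha> (limit w) v) :: ennreal)
          \<in> borel_measurable (borel \<Otimes>\<^sub>M Pi\<^sub>M UNIV (\<lambda>_. borel))"
        unfolding split_beta' by (intro borel_measurable_times_ennreal)
    qed
    also have "\<dots> = (\<integral>\<^sup>+ w. ?m w \<partial>unifs)"
    proof (intro nn_integral_cong_AE)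
      have "AE w in unifs. limit w > 0"
        using AE_limit_step by eventually_elim (metis step_pos)
      thus "AE w in unifs. (\<integral>\<^sup>+ v. indicator B w * indicator {k} (bnb_count r \<alpha> (limit w) v) \<partial>unif) = ?m w"
      proof eventually_elim
        case (elim w)
        have "(\<integral>\<^sup>+ v. indicator {k} (bnb_count r \<alpha> (limit w) v) \<partial>unif)
            = (\<integral>\<^sup>+ v. indicator {v. bnb_count r \<alpha> (limit w) v = k} v \<partial>unif)"
          by (intro nn_integral_cong) (auto simp: indicator_def)
        also have "\<dots> = ennreal (bnb_mass (limit w) r \<alpha> k)"
          by (subst nn_integral_indicator) (simp_all add: emeasure_bnb_count[OF r \<alpha> elim])
        finally show ?case by (cases "w \<in> B") simp_all
      qed
    qed
    also have "\<dots> = (\<integral>\<^sup>+ \<omega>. ?m (past t \<omega>) \<partial>M)"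
      by (rule nn_integral_past[symmetric]) measurable
    also have "\<dots> = (\<integral>\<^sup>+ \<omega>. ennreal (indicator A \<omega> * g \<omega>) \<partial>M)"
    proof (intro nn_integral_cong_AE)
      show "AE \<omega> in M. ?m (past t \<omega>) = ennreal (indicator A \<omega> * g \<omega>)"
        using g_eq AE_space
      proof eventually_elim
        case (elim \<omega>)
        thus ?case by (auto simp: AB intensity_def indicator_def)
      qed
    qed
    finally have nn: "(\<integral>\<^sup>+ \<omega>. ennreal (indicator A \<omega> * indicator {\<omega>. obs t \<omega> = k} \<omega>) \<partial>M)
        = (\<integral>\<^sup>+ \<omega>. ennreal (indicator A \<omega> * g \<omega>) \<partial>M)" .
    have "(LINT \<omega>|M. indicator A \<omega> * indicator {\<omega>. obs t \<omega> = k} \<omega>) = (LINT \<omega>|M. indicator A \<omega> * g \<omega>)"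
    proof (subst (1 2) integral_eq_nn_integral)
      show "AE \<omega> in M. 0 \<le> indicator A \<omega> * g \<omega>"
        using g_eq by eventually_elim (simp add: indicator_def)
    qed (auto simp: nn)
    thus "(\<integral>\<omega>\<in>A. indicator {\<omega>. obs t \<omega> = k} \<omega> \<partial>M) = (\<integral>\<omega>\<in>A. g \<omega> \<partial>M)"
      by (simp add: set_lebesgue_integral_def)
  qed
  thus "AE \<omega> in M. real_cond_exp M ?F (indicator {\<omega>. obs t \<omega> = k}) \<omega> = bnb_mass (intensity t \<omega>) r \<alpha> k"
    using g_eq by eventually_elim simp
qed

end

section \<open>Existence, uniqueness and measurability\<close>

lemma lipschitz_tendsto_at_right_0:
  fixes f :: "real \<Rightarrow> real"
  assumes "\<And>x y. x > 0 \<Longrightarrow> y > 0 \<Longrightarrow> \<bar>f x - f y\<bar> \<le> c * \<bar>x - y\<bar>" "c \<ge> 0"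
  obtains a where "(f \<longlongrightarrow> a) (at_right 0)"
proof -
  have "c-lipschitz_on {0<..} f"
    using assms by (intro lipschitz_onI) (auto simp: dist_real_def)
  hence "uniformly_continuous_on {0<..} f"
    by (rule lipschitz_on_uniformly_continuous)
  moreover have "(0::real) \<in> closure {0<..}" by simp
  ultimately obtain a where "(f \<longlongrightarrow> a) (at_right 0)"
    by (rule uniformly_continuous_on_extension_at_closure)
  thus ?thesis by (rule that)
qed

theorem theorem3p1:
  fixes M :: "'a measure" and u :: "int \<Rightarrow> 'a \<Rightarrow> real"
    and g :: "real ^ 'n \<Rightarrow> nat \<Rightarrow> real \<Rightarrow> real" and \<theta> :: "real ^ 'n"
    and r \<alpha> c1 c2 :: real
  assumes "prob_space M"
    and "iid_uniform M u"
    and "r > 0" and "\<alpha> > 1"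
    and "\<And>y l. l > 0 \<Longrightarrow> g \<theta> y l > 0"
    and "c1 > 0" and "c2 > 0" and "c1 + c2 < 1"
    and "\<And>y y' l l'. l > 0 \<Longrightarrow> l' > 0 \<Longrightarrow>
           \<bar>g \<theta> y l - g \<theta> y' l'\<bar> \<le> c1 * \<bar>real y - real y'\<bar> + c2 * \<bar>l - l'\<bar>"
    and "\<not> (g \<theta> 0 \<longlongrightarrow> 0) (at_right 0)"
  shows "\<exists>y l.
     stationary_ergodic_causal_solution M r \<alpha> (g \<theta>) u y l \<and>
     conditionally_bnb M r \<alpha> y l \<and>
     (\<forall>y' l'. stationary_ergodic_causal_solution M r \<alpha> (g \<theta>) u y' l' \<longrightarrow>
        (AE \<omega> in M. \<forall>t. y' t \<omega> = y t \<omega> \<and> l' t \<omega> = l t \<omega>)) \<and>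
     (\<exists>ginf \<in> borel_measurable (Pi\<^sub>M UNIV (\<lambda>_::nat. count_space (UNIV :: nat set))).
        \<forall>t. AE \<omega> in M. l t \<omega> = ginf (\<lambda>i. y (t - 1 - int i) \<omega>))"
proof -
  let ?G = "g \<theta>"
  have lip0: "\<bar>?G 0 x - ?G 0 y\<bar> \<le> c2 * \<bar>x - y\<bar>" if "x > 0" "y > 0" for x y
    using assms(9)[OF that, of 0 0] by simp
  obtain a where a: "(?G 0 \<longlongrightarrow> a) (at_right 0)"
    by (rule lipschitz_tendsto_at_right_0[OF lip0]) (use assms(7) in auto)
  have "a \<ge> 0"
    by (rule tendsto_lowerbound[OF a])
       (auto intro!: eventually_mono[OF eventually_at_right_less] less_imp_le assms(5))
  moreover have "a \<noteq> 0" using a assms(10) by blast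
  ultimately have a_pos: "a > 0" by simp
  interpret prob_space M by fact
  interpret bnb_driven r \<alpha> c1 c2 a ?G M u
    by unfold_locales (fact assms(3) assms(4) assms(5) assms(6) assms(7) assms(8) assms(9) assms(2) a a_pos)+
  show ?thesis
  proof (intro exI conjI allI impI)
    show "stationary_ergodic_causal_solution M r \<alpha> ?G u obs intensity"
      by (rule stationary_ergodic_causal_solution_obs)
    show "conditionally_bnb M r \<alpha> obs intensity"
      by (rule conditionally_bnb_obs)
    show "AE \<omega> in M. \<forall>t. y' t \<omega> = obs t \<omega> \<and> l' t \<omega> = intensity t \<omega>"
      if "stationary_ergodic_causal_solution M r \<alpha> ?G u y' l'" for y' l'
      using that by (rule solution_unique)
    show "\<exists>ginf\<in>borel_measurable (Pi\<^sub>M UNIV (\<lambda>_::nat. count_space (UNIV :: nat set))).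
        \<forall>t. AE \<omega> in M. intensity t \<omega> = ginf (\<lambda>i. obs (t - 1 - int i) \<omega>)"
      using measurable_unrolled AE_intensity_eq_unrolled by blast
  qed
qed

end
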